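(* Let $\mathcal{F}=\{g_0\}\cup\{g_\lambda : \lambda\in\Lambda\}$ be a uniform covering frame on $\mathbb{R}^d$, let $\tilde{S}_{\mathcal{F}}$ be the associated Fourier scattering transform, and let $D:=\sup\{|\xi| : \hat{g}_0(\xi)\neq0\}$, assumed finite. Then for all $f\in L^2(\mathbb{R}^d)$ and all $c\in\mathbb{R}^d$, $$\left\|\tilde{S}_{\mathcal{F}}(f)-\tilde{S}_{\mathcal{F}}(T_cf)\right\|_{L^2l^2}\leq 2\pi D|c|\,\|f\|_{L^2}.$$
   Context: Functions are complex-valued on $\mathbb{R}^d$. The Fourier transform is normalized as $\hat{f}(\xi)=\int_{\mathbb{R}^d}f(x)e^{-2\pi i x\cdot\xi}\,dx$ (extended to $L^2$ by Plancherel). Translation: $(T_cf)(x):=f(x-c)$. A semi-discrete Bessel sequence is a sequence (countable family) $\mathcal{G}$ of functions in $L^1(\mathbb{R}^d)\cap L^2(\mathbb{R}^d)$ with $\sum_{g\in\mathcal{G}}|\hat{g}(\xi)|^2\leq 1$ for a.e. $\xi$. If $\mathcal{G}=\{g_\lambda\}_{\lambda\in\Lambda}\cup\{g_0\}$ for a set $\Lambda$ with $0\notin\Lambda$, we say $\mathcal{G}$ has index set $\Lambda$ and output-generating function $g_0$. Uniform covering frame: a semi-discrete Bessel sequence $\mathcal{F}=\{g_0\}\cup\{g_\lambda:\lambda\in\Lambda\}$ such that (1) $g_0\in L^1\cap L^2$, $\hat{g}_0$ is supported in a neighborhood of the origin and $|\hat{g}_0(0)|=1$, and for each $\lambda\in\Lambda$,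 $g_\lambda\in L^1\cap L^2$ and $\operatorname{supp}(\hat{g}_\lambda)$ is compact and connected; (2) there exists $R$ such that for each $\lambda\in\Lambda$ there is $\xi_\lambda\in\mathbb{R}^d$ with $\operatorname{supp}(\hat{g}_\lambda)$ contained in the open ball of radius $R$ centered at $\xi_\lambda$; (3) $|\hat{g}_0(\xi)|^2+\sum_{\lambda\in\Lambda}|\hat{g}_\lambda(\xi)|^2=1$ for all $\xi\in\mathbb{R}^d$. Scattering propagator: for $p=(\lambda_1,\dots,\lambda_k)\in\Lambda^k$ and $f\in L^2(\mathbb{R}^d)$, define inductively $\tilde{U}[p]f:=f$ if $k=0$ (the empty path), and $\tilde{U}[p]f:=\left|\tilde{U}[\lambda_1,\dots,\lambda_{k-1}]f*g_{\lambda_k}\right|$ if $k\geq1$. Fourier scattering transform: with $P:=\bigcup_{n=0}^\infty\Lambda^n$, $\tilde{S}_{\mathcal{F}}(f)=\tilde{S}_{\mathcal{F}}[P]f:=\{\tilde{U}[p]f*g_0\}_{p\in P}$. For a family $\{h_p\}_{p\in P}$ of $L^2$ functions, $\|\{h_p\}\|_{L^2l^2}^2:=\sum_{p\in P}\|h_p\|_{L^2}^2$; differences of such families are taken entrywise. *)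

theory Defs
  imports "HOL-Analysis.Analysis"
begin

text \<open>Elements of the Lebesgue spaces are represented by Lebesgue measurable functions rather than
  by their classes modulo equality almost everywhere.\<close>

definition L1 :: "('a::euclidean_space \<Rightarrow> complex) set" where
  "L1 = {f. integrable lebesgue f}"

definition L2 :: "('a::euclidean_space \<Rightarrow> complex) set" where
  "L2 = {f \<in> borel_measurable lebesgue. integrable lebesgue (\<lambda>x. (cmod (f x))\<^sup>2)}"

definition enn_sqrt :: "ennreal \<Rightarrow> ennreal" where
  "enn_sqrt t = (if t = \<infinity> then \<infinity> else ennreal (sqrt (enn2real t)))"

text \<open>Norms take values in the extended nonnegative reals, so that a bound on a norm by a finite
  number includes the assertion that the norm is finite.\<close>

definition L2_norm :: "('a::euclidean_space \<Rightarrow> complex) \<Rightarrow> ennreal" where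
  "L2_norm f = enn_sqrt (\<integral>\<^sup>+ x. ennreal ((cmod (f x))\<^sup>2) \<partial>lebesgue)"

definition L2l2_norm :: "'p set \<Rightarrow> ('p \<Rightarrow> 'a::euclidean_space \<Rightarrow> complex) \<Rightarrow> ennreal" where
  "L2l2_norm P h = enn_sqrt (\<Sum>\<^sub>\<infinity>p\<in>P. (L2_norm (h p))\<^sup>2)"

definition fourier :: "('a::euclidean_space \<Rightarrow> complex) \<Rightarrow> 'a \<Rightarrow> complex" where
  "fourier f \<xi> = (LINT x|lebesgue. f x * exp (- 2 * of_real pi * \<i> * of_real (x \<bullet> \<xi>)))"

definition translate :: "'a::euclidean_space \<Rightarrow> ('a \<Rightarrow> complex) \<Rightarrow> 'a \<Rightarrow> complex" where
  "translate c f = (\<lambda>x. f (x - c))"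

text \<open>For \<open>f \<in> L2\<close> and \<open>g \<in> L1\<close> the integrand is integrable for almost every \<open>x\<close>; at the remaining
  points the Bochner integral returns \<open>0\<close>.\<close>

definition conv :: "('a::euclidean_space \<Rightarrow> complex) \<Rightarrow> ('a \<Rightarrow> complex) \<Rightarrow> 'a \<Rightarrow> complex" where
  "conv f g x = (LINT y|lebesgue. f (x - y) * g y)"

definition supp :: "('a::euclidean_space \<Rightarrow> complex) \<Rightarrow> 'a set" where
  "supp h = closure {\<xi>. h \<xi> \<noteq> 0}"

text \<open>Sums over index sets are formed in \<^typ>\<open>ennreal\<close>, where every family is summable.\<close>

definition semi_discrete_Bessel :: "'i set \<Rightarrow> ('i \<Rightarrow> 'a::euclidean_space \<Rightarrow> complex) \<Rightarrow> bool" where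
  "semi_discrete_Bessel I G \<longleftrightarrow>
     countable I \<and> (\<forall>i\<in>I. G i \<in> L1 \<inter> L2) \<and>
     (AE \<xi> in lebesgue. (\<Sum>\<^sub>\<infinity>i\<in>I. ennreal ((cmod (fourier (G i) \<xi>))\<^sup>2)) \<le> 1)"

text \<open>The family \<open>{g0} \<union> {g l | l \<in> \<Lambda>}\<close> is indexed by \<open>{None} \<union> Some ` \<Lambda>\<close>, with \<^const>\<open>None\<close> playing
  the role of the extra index \<open>0 \<notin> \<Lambda>\<close>. That the Fourier transform of \<open>g0\<close> is supported in a
  neighborhood of the origin is not meant to include boundedness of that neighborhood.\<close>

definition uniform_covering_frame ::
    "'l set \<Rightarrow> ('a::euclidean_space \<Rightarrow> complex) \<Rightarrow> ('l \<Rightarrow> 'a \<Rightarrow> complex) \<Rightarrow> bool" where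
  "uniform_covering_frame \<Lambda> g0 g \<longleftrightarrow>
     semi_discrete_Bessel (insert None (Some ` \<Lambda>)) (case_option g0 g) \<and>
     (\<exists>U. open U \<and> 0 \<in> U \<and> supp (fourier g0) \<subseteq> U) \<and>
     cmod (fourier g0 0) = 1 \<and>
     (\<forall>l\<in>\<Lambda>. compact (supp (fourier (g l))) \<and> connected (supp (fourier (g l)))) \<and>
     (\<exists>R. \<forall>l\<in>\<Lambda>. \<exists>\<xi>. supp (fourier (g l)) \<subseteq> ball \<xi> R) \<and>
     (\<forall>\<xi>. ennreal ((cmod (fourier g0 \<xi>))\<^sup>2) +
           (\<Sum>\<^sub>\<infinity>l\<in>\<Lambda>. ennreal ((cmod (fourier (g l) \<xi>))\<^sup>2)) = 1)"

definition scatter_prop ::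
    "('l \<Rightarrow> 'a::euclidean_space \<Rightarrow> complex) \<Rightarrow> 'l list \<Rightarrow> ('a \<Rightarrow> complex) \<Rightarrow> 'a \<Rightarrow> complex" where
  "scatter_prop g p f = foldl (\<lambda>h l x. of_real (cmod (conv h (g l) x))) f p"

lemma scatter_prop_Nil: "scatter_prop g [] f = f"
  by (simp add: scatter_prop_def)

lemma scatter_prop_snoc:
  "scatter_prop g (p @ [l]) f = (\<lambda>x. of_real (cmod (conv (scatter_prop g p f) (g l) x)))"
  by (simp add: scatter_prop_def)

definition scatter ::
    "('a::euclidean_space \<Rightarrow> complex) \<Rightarrow> ('l \<Rightarrow> 'a \<Rightarrow> complex) \<Rightarrow> ('a \<Rightarrow> complex) \<Rightarrow>
     'l list \<Rightarrow> 'a \<Rightarrow> complex" where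
  "scatter g0 g f p = conv (scatter_prop g p f) g0"

end

(* Scattering commutes with translations, so each output changes by F - T_c F with F = U[p]f * g0,
   whose Fourier transform is that of F multiplied by 1 - exp(-2 pi i c.xi), of modulus at most
   2 pi D |c| on the band of g0.  By the Bessel bound the energy |h|^2 of a layer dominates
   |h * g0|^2 plus the energy of the next layer, so the outputs of all layers telescope to at most
   |f|^2.  Both steps are Fourier multiplier bounds, which need Plancherel only for continuous bounded
   integrable functions (Gaussian regularization); density in L^2 extends them. *)

theory Submission
  imports Defs "HOL-Probability.Characteristic_Functions"
begin

section \<open>Affine substitutions and the Gaussian\<close>

text \<open>\<open>fourier\<close> is a Bochner integral with default value 0, so it carries no
  information about a function in \<open>L2\<close> that is not integrable, and the layers
  \<open>scatter_prop g p f\<close> are known only to have finite energy. Frequency-side arguments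
  are therefore confined to \<open>conv u k\<close> with \<open>u\<close> continuous, bounded and
  integrable and \<open>k\<close> integrable. The results compare squared norms without transforming
  \<open>h\<close>, and such inequalities survive approximation of \<open>h\<close> by
  \<open>u\<close>.

  Two points fix the shape of the estimates. The translation bound keeps the squared norm of the
  output \<open>conv h g0\<close> on its right side; with that of \<open>h\<close> instead, the sum
  over infinitely many layers would be uncontrolled. The Bessel bound is proved for finite families,
  where the approximation error has a finite constant; a sum in \<open>ennreal\<close> is the
  supremum of its finite partial sums.

  Fubini arguments are carried out for Borel functions and \<open>lborel\<close>. Changing a
  function on a null set alters a convolution at no point, so Borel representatives give exactly the
  same scattering outputs.\<close>

lemma nn_integral_lborel_affine:
  fixes f :: "'a::euclidean_space \<Rightarrow> ennreal"
  assumes [measurable]: "f \<in> borel_measurable borel" and c: "c \<noteq> 0"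
  shows "(\<integral>\<^sup>+x. f x \<partial>lborel) = ennreal (\<bar>c\<bar> ^ DIM('a)) * (\<integral>\<^sup>+x. f (t + c *\<^sub>R x) \<partial>lborel)"
  by (subst lborel_affine[OF c, of t])
     (simp add: nn_integral_density nn_integral_distr nn_integral_cmult)

lemma lborel_integrable_affine_iff:
  fixes f :: "'a::euclidean_space \<Rightarrow> 'b::{banach, second_countable_topology}"
  assumes [measurable]: "f \<in> borel_measurable borel" and c: "c \<noteq> 0"
  shows "integrable lborel (\<lambda>x. f (t + c *\<^sub>R x)) \<longleftrightarrow> integrable lborel f"
  using c nn_integral_lborel_affine[of "\<lambda>x. ennreal (norm (f x))" c t]
  by (auto simp: integrable_iff_bounded ennreal_mult_less_top)

lemma lborel_integral_affine:
  fixes f :: "'a::euclidean_space \<Rightarrow> 'b::{banach, second_countable_topology}"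
  assumes [measurable]: "f \<in> borel_measurable borel" and c: "c \<noteq> 0"
  shows "(LINT x|lborel. f x) = \<bar>c\<bar> ^ DIM('a) *\<^sub>R (LINT x|lborel. f (t + c *\<^sub>R x))"
  by (subst lborel_affine[OF c, of t]) (simp add: integral_density integral_distr)

lemma nn_integral_lborel_diff:
  fixes f :: "'a::euclidean_space \<Rightarrow> ennreal"
  assumes "f \<in> borel_measurable borel"
  shows "(\<integral>\<^sup>+x. f (x - t) \<partial>lborel) = (\<integral>\<^sup>+x. f x \<partial>lborel)"
    and "(\<integral>\<^sup>+x. f (t - x) \<partial>lborel) = (\<integral>\<^sup>+x. f x \<partial>lborel)"
  using nn_integral_lborel_affine[OF assms, of 1 "- t"] nn_integral_lborel_affine[OF assms, of "-1" t]
  by simp_all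

lemma lborel_integrable_diff_iff:
  fixes f :: "'a::euclidean_space \<Rightarrow> 'b::{banach, second_countable_topology}"
  assumes "f \<in> borel_measurable borel"
  shows "integrable lborel (\<lambda>x. f (x - t)) \<longleftrightarrow> integrable lborel f"
    and "integrable lborel (\<lambda>x. f (t - x)) \<longleftrightarrow> integrable lborel f"
  using lborel_integrable_affine_iff[OF assms, of 1 "- t"] lborel_integrable_affine_iff[OF assms, of "-1" t]
  by simp_all

lemma lborel_integral_diff:
  fixes f :: "'a::euclidean_space \<Rightarrow> 'b::{banach, second_countable_topology}"
  assumes "f \<in> borel_measurable borel"
  shows "(LINT x|lborel. f (x - t)) = (LINT x|lborel. f x)"
    and "(LINT x|lborel. f (t - x)) = (LINT x|lborel. f x)"
  using lborel_integral_affine[OF assms, of 1 "- t"] lborel_integral_affine[OF assms, of "-1" t]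
  by simp_all

text \<open>By \<open>lborel_eq\<close> the measure is the image of a product of one-dimensional
  measures over \<open>Basis\<close>, so an integrand that separates in the coordinates splits. This
  reduces the Gaussian transform to one variable.\<close>

lemma lborel_prod_Basis:
  fixes f :: "'a::euclidean_space \<Rightarrow> real \<Rightarrow> complex"
  assumes "\<And>b. b \<in> Basis \<Longrightarrow> integrable lborel (f b)"
  shows "integrable lborel (\<lambda>x. \<Prod>b\<in>Basis. f b (x \<bullet> b))"
    and "(LINT x|lborel. (\<Prod>b\<in>Basis. f b (x \<bullet> b))) = (\<Prod>b\<in>Basis. LINT x|lborel. f b x)"
proof -
  interpret product_sigma_finite "\<lambda>_::'a. lborel :: real measure" ..
  have [measurable]: "f b \<in> borel_measurable borel" if "b \<in> Basis" for b
    using assms[OF that] by auto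
  have eq: "(\<Prod>b\<in>Basis. f b ((\<Sum>b\<in>Basis. g b *\<^sub>R b) \<bullet> b)) = (\<Prod>b\<in>Basis. f b (g b))" for g :: "'a \<Rightarrow> real"
    by (intro prod.cong) (simp_all add: inner_sum_left_Basis)
  show "integrable lborel (\<lambda>x. \<Prod>b\<in>Basis. f b (x \<bullet> b))"
    by (subst lborel_eq, subst integrable_distr_eq)
       (simp_all only: eq product_integrable_prod assms finite_Basis, measurable)
  show "(LINT x|lborel. (\<Prod>b\<in>Basis. f b (x \<bullet> b))) = (\<Prod>b\<in>Basis. LINT x|lborel. f b x)"
    by (subst lborel_eq, subst integral_distr)
       (simp_all only: eq product_integral_prod assms finite_Basis, measurable)
qed

text \<open>With \<open>pi\<close> in the exponent the Gaussian has total mass 1 and is its own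
  transform in every dimension, for the normalization used in \<open>fourier\<close>.\<close>

definition gauss :: "'a::euclidean_space \<Rightarrow> real" where
  "gauss x = exp (- pi * (norm x)\<^sup>2)"

lemma gauss_pos: "0 < gauss x"
  by (simp add: gauss_def)

lemma gauss_nonneg [simp]: "0 \<le> gauss x"
  by (simp add: gauss_def)

lemma gauss_le_1: "gauss x \<le> 1"
  by (simp add: gauss_def)

lemma continuous_gauss: "continuous_on UNIV gauss"
  unfolding gauss_def by (intro continuous_intros)

lemma borel_measurable_gauss [measurable]: "gauss \<in> borel_measurable borel"
  by (rule borel_measurable_continuous_onI[OF continuous_gauss])

text \<open>Scaling the variable by \<open>sqrt (2 * pi)\<close> turns the Gaussian into the
  standard normal density, whose characteristic function is known; the transform is its value at
  \<open>- sqrt (2 * pi) * \<xi>\<close>.\<close>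

lemma gauss_real_fourier:
  shows "integrable lborel (\<lambda>x::real. complex_of_real (exp (- pi * x\<^sup>2)) * exp (- 2 * of_real pi * \<i> * of_real (x * \<xi>)))"
    and "(LINT x|lborel. complex_of_real (exp (- pi * x\<^sup>2)) * exp (- 2 * of_real pi * \<i> * of_real (x * \<xi>)))
       = of_real (exp (- pi * \<xi>\<^sup>2))"
proof -
  let ?s = "sqrt (2 * pi)"
  let ?f = "\<lambda>x. std_normal_density x *\<^sub>R cis (- ?s * \<xi> * x)"
  let ?F = "\<lambda>x. complex_of_real (exp (- pi * x\<^sup>2)) * exp (- 2 * of_real pi * \<i> * of_real (x * \<xi>))"
  have s: "?s > 0" "?s * ?s = 2 * pi" by simp_all
  have F: "?F x = ?s *\<^sub>R ?f (0 + ?s * x)" for x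
  proof -
    have "exp (- 2 * of_real pi * \<i> * of_real (x * \<xi>)) = cis (- ?s * \<xi> * (?s * x))"
      using s(2) by (simp add: cis_conv_exp algebra_simps)
    moreover have "exp (- pi * x\<^sup>2) = ?s * std_normal_density (?s * x)"
      using s by (simp add: std_normal_density_def power_mult_distrib)
    ultimately show ?thesis
      by (simp add: scaleR_conv_of_real)
  qed
  have int: "integrable lborel ?f"
    by (rule Bochner_Integration.integrable_bound[where f=std_normal_density])
       (auto simp: integrable_normal_density cis_conv_exp)
  show "integrable lborel ?F"
    unfolding F by (rule integrable_scaleR_right) (use lborel_integrable_real_affine[OF int, of ?s 0] s in simp)
  have "(LINT x|lborel. ?F x) = ?s *\<^sub>R (LINT x|lborel. ?f (0 + ?s * x))"
    unfolding F by (rule integral_scaleR_right)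
  also have "\<dots> = (LINT x|lborel. ?f x)"
    using lborel_integral_real_affine[of ?s ?f 0] s by simp
  also have "\<dots> = char std_normal_distribution (- ?s * \<xi>)"
    unfolding char_def by (subst integral_density) (auto simp: cis_conv_exp normal_density_nonneg)
  also have "\<dots> = of_real (exp (- pi * \<xi>\<^sup>2))"
    unfolding char_std_normal_distribution by (simp add: power_mult_distrib)
  finally show "(LINT x|lborel. ?F x) = of_real (exp (- pi * \<xi>\<^sup>2))" .
qed

lemma norm_power2_Basis: "(norm (x::'a::euclidean_space))\<^sup>2 = (\<Sum>b\<in>Basis. (x \<bullet> b)\<^sup>2)"
  by (simp add: power2_norm_eq_inner euclidean_inner[of x x] flip: power2_eq_square)

lemma gauss_fourier_lborel:
  fixes \<xi> :: "'a::euclidean_space"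
  shows "integrable lborel (\<lambda>x. complex_of_real (gauss x) * exp (- 2 * of_real pi * \<i> * of_real (x \<bullet> \<xi>)))"
    and "(LINT x|lborel. complex_of_real (gauss x) * exp (- 2 * of_real pi * \<i> * of_real (x \<bullet> \<xi>))) = of_real (gauss \<xi>)"
proof -
  let ?f = "\<lambda>b x. complex_of_real (exp (- pi * x\<^sup>2)) * exp (- 2 * of_real pi * \<i> * of_real (x * (\<xi> \<bullet> b)))"
  have eq: "complex_of_real (gauss x) * exp (- 2 * of_real pi * \<i> * of_real (x \<bullet> \<xi>)) = (\<Prod>b\<in>Basis. ?f b (x \<bullet> b))" for x
    by (simp add: prod.distrib gauss_def norm_power2_Basis euclidean_inner[of x \<xi>] sum_distrib_left
        flip: exp_sum of_real_prod sum_negf)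
  show "integrable lborel (\<lambda>x. complex_of_real (gauss x) * exp (- 2 * of_real pi * \<i> * of_real (x \<bullet> \<xi>)))"
    unfolding eq by (intro lborel_prod_Basis gauss_real_fourier)
  have "(LINT x|lborel. complex_of_real (gauss x) * exp (- 2 * of_real pi * \<i> * of_real (x \<bullet> \<xi>)))
     = (\<Prod>b\<in>Basis. complex_of_real (exp (- pi * (\<xi> \<bullet> b)\<^sup>2)))"
    unfolding eq by (subst lborel_prod_Basis(2)) (simp_all only: gauss_real_fourier)
  also have "\<dots> = of_real (gauss \<xi>)"
    by (simp add: gauss_def norm_power2_Basis sum_distrib_left flip: exp_sum of_real_prod sum_negf)
  finally show "(LINT x|lborel. complex_of_real (gauss x) * exp (- 2 * of_real pi * \<i> * of_real (x \<bullet> \<xi>))) = of_real (gauss \<xi>)" .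
qed

lemma integrable_gauss: "integrable lborel (gauss :: 'a::euclidean_space \<Rightarrow> real)"
  and integral_gauss: "(LINT x|lborel. gauss (x::'a)) = 1"
  using gauss_fourier_lborel[of "0::'a"] by (simp_all add: complex_of_real_integrable_eq gauss_def[of 0])

section \<open>Convolution and Fourier transform\<close>

text \<open>Measurability on products, as needed for Fubini, is available for Borel functions. Real
  and imaginary parts are treated separately because the completion result is about real
  functions.\<close>

lemma borel_representative:
  fixes f :: "'a::euclidean_space \<Rightarrow> complex"
  assumes "f \<in> borel_measurable lebesgue"
  obtains f' where "f' \<in> borel_measurable borel" "AE x in lborel. f x = f' x"
proof -
  have "(\<lambda>x. Re (f x)) \<in> borel_measurable lebesgue" "(\<lambda>x. Im (f x)) \<in> borel_measurable lebesgue"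
    using assms by (auto intro: measurable_compose)
  from this[THEN completion_ex_borel_measurable_real]
  obtain r i where [measurable]: "r \<in> borel_measurable lborel" "i \<in> borel_measurable lborel"
    and "AE x in lborel. Re (f x) = r x" "AE x in lborel. Im (f x) = i x"
    by blast
  then have "AE x in lborel. f x = Complex (r x) (i x)"
    by (auto simp: complex_eq_iff)
  moreover have "(\<lambda>x. Complex (r x) (i x)) \<in> borel_measurable borel"
    unfolding Complex_eq by measurable
  ultimately show ?thesis using that by blast
qed

section \<open>Null sets and measurability under reflections\<close>

lemma lborel_distr_diff: "distr lborel borel (\<lambda>y. x - y) = (lborel :: 'a::euclidean_space measure)"
  using lborel_affine[of "-1" x] by (simp add: density_1)

lemma AE_lborel_diff:
  assumes "AE y in lborel. P (y::'a::euclidean_space)"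
  shows "AE y in lborel. P (x - y)"
proof -
  have "AE y in distr lborel borel (\<lambda>y. x - y). P y"
    by (subst lborel_distr_diff) (rule assms)
  then show ?thesis by (rule AE_distrD[rotated]) simp
qed

text \<open>Lebesgue measurability need not survive composition with a continuous map; it does here
  because the reflection is affine and invertible, so it pulls null sets back to null sets.\<close>

lemma lebesgue_measurable_diff:
  fixes f :: "'a::euclidean_space \<Rightarrow> 'b::topological_space"
  assumes "f \<in> borel_measurable lebesgue"
  shows "(\<lambda>y. f (x - y)) \<in> borel_measurable lebesgue"
proof -
  have "(\<lambda>y. x - y) = (\<lambda>y. x + (\<Sum>j\<in>Basis. (-1 * (y \<bullet> j)) *\<^sub>R j))"
    by (simp add: sum_negf euclidean_representation)
  then have "(\<lambda>y. x - y) \<in> lebesgue \<rightarrow>\<^sub>M lebesgue"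
    using lebesgue_affine_measurable[of "\<lambda>_. -1" x] by simp
  then show ?thesis using assms by (rule measurable_compose)
qed

lemma fourier_lborel:
  assumes [measurable]: "f \<in> borel_measurable borel"
  shows "fourier f \<xi> = (LINT x|lborel. f x * exp (- 2 * of_real pi * \<i> * of_real (x \<bullet> \<xi>)))"
  unfolding fourier_def by (rule integral_completion) measurable

lemma conv_lborel:
  assumes [measurable]: "h \<in> borel_measurable borel" "k \<in> borel_measurable borel"
  shows "conv h k x = (LINT y|lborel. h (x - y) * k y)"
  unfolding conv_def by (rule integral_completion) measurable

lemma fourier_cong_AE:
  fixes f g :: "'a::euclidean_space \<Rightarrow> complex"
  assumes [measurable]: "f \<in> borel_measurable lebesgue" "g \<in> borel_measurable lebesgue"
    and AE: "AE x in lborel. f x = g x"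
  shows "fourier f = fourier g"
proof
  fix \<xi> :: 'a
  have [measurable]: "(\<lambda>x. exp (- 2 * of_real pi * \<i> * of_real (x \<bullet> \<xi>)) :: complex) \<in> borel_measurable lebesgue"
    by (intro measurable_completion) measurable
  show "fourier f \<xi> = fourier g \<xi>"
    unfolding fourier_def
    by (rule integral_cong_AE) (measurable, use AE_completion[OF AE] in auto)
qed

text \<open>For each fixed \<open>x\<close> the exceptional set of \<open>h\<close>, reflected and
  shifted, is still null, so the integrands agree almost everywhere. Hence the convolutions agree at
  every point, including those where the integral takes its default value.\<close>

lemma conv_cong_AE:
  fixes h h' k k' :: "'a::euclidean_space \<Rightarrow> complex"
  assumes [measurable]: "h \<in> borel_measurable lebesgue" "h' \<in> borel_measurable lebesgue"
    "k \<in> borel_measurable lebesgue" "k' \<in> borel_measurable lebesgue"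
    and AE: "AE x in lborel. h x = h' x" "AE x in lborel. k x = k' x"
  shows "conv h k = conv h' k'"
proof
  fix x
  have [measurable]: "(\<lambda>y. h (x - y)) \<in> borel_measurable lebesgue" "(\<lambda>y. h' (x - y)) \<in> borel_measurable lebesgue"
    by (simp_all add: lebesgue_measurable_diff)
  have "AE y in lebesgue. h (x - y) = h' (x - y)" "AE y in lebesgue. k y = k' y"
    using AE_completion[OF AE_lborel_diff[OF AE(1)]] AE_completion[OF AE(2)] by auto
  then show "conv h k x = conv h' k' x"
    unfolding conv_def by (intro integral_cong_AE) auto
qed

lemma borel_measurable_conv [measurable]:
  fixes h k :: "'a::euclidean_space \<Rightarrow> complex"
  assumes [measurable]: "h \<in> borel_measurable borel" "k \<in> borel_measurable borel"
  shows "conv h k \<in> borel_measurable borel"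
proof -
  have "(\<lambda>x. LINT y|lborel. h (x - y) * k y) \<in> borel_measurable borel"
    by (rule lborel.borel_measurable_lebesgue_integral) measurable
  then show ?thesis
    by (simp add: conv_lborel[OF assms] cong: measurable_cong)
qed

lemma
  fixes h k :: "'a::euclidean_space \<Rightarrow> complex"
  assumes h: "integrable lborel h" and k: "integrable lborel k"
  shows integrable_conv: "integrable lborel (conv h k)"
    and integral_conv: "(LINT x|lborel. conv h k x) = (LINT x|lborel. h x) * (LINT x|lborel. k x)"
proof -
  have [measurable]: "h \<in> borel_measurable borel" "k \<in> borel_measurable borel"
    using h k by auto
  have int: "integrable lborel (\<lambda>x. h (x - y))" for y
    using h by (subst lborel_integrable_diff_iff) auto
  have "integrable (lborel \<Otimes>\<^sub>M lborel) (\<lambda>(y, x). h (x - y) * k y)"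
  proof (rule lborel_pair.Fubini_integrable)
    have "(\<lambda>y. LINT x|lborel. norm (case (y, x) of (y, x) \<Rightarrow> h (x - y) * k y))
        = (\<lambda>y. (LINT x|lborel. norm (h x)) * norm (k y))"
      by (simp add: norm_mult lborel_integral_diff(1)[of "\<lambda>x. norm (h x)"])
    then show "integrable lborel (\<lambda>y. LINT x|lborel. norm (case (y, x) of (y, x) \<Rightarrow> h (x - y) * k y))"
      using k by simp
  qed (use int in auto)
  note * = lborel_pair.integrable_snd[OF this] lborel_pair.integral_snd[OF this] lborel_pair.integral_fst[OF this]
  have eq: "conv h k = (\<lambda>x. LINT y|lborel. h (x - y) * k y)"
    by (rule ext, rule conv_lborel) measurable
  show "integrable lborel (conv h k)"
    using *(1) by (simp add: eq)
  show "(LINT x|lborel. conv h k x) = (LINT x|lborel. h x) * (LINT x|lborel. k x)"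
    unfolding eq using *(2,3) by (simp add: lborel_integral_diff(1)[of h])
qed

lemma norm_fourier_kernel [simp]:
  "cmod (exp (- (2 * complex_of_real pi * \<i> * complex_of_real t))) = 1"
  by simp

lemma integrable_fourier_kernel:
  fixes h :: "'a::euclidean_space \<Rightarrow> complex"
  assumes "integrable lborel h"
  shows "integrable lborel (\<lambda>x. h x * exp (- 2 * of_real pi * \<i> * of_real (x \<bullet> \<xi>)))"
  using assms by (rule Bochner_Integration.integrable_bound) (use assms in \<open>auto simp: norm_mult\<close>)

text \<open>The kernel is a character of the additive group: multiplying a convolution by it amounts
  to multiplying both factors by it. What remains is the multiplicativity of the total integral in
  \<open>integral_conv\<close>.\<close>

lemma fourier_conv:
  fixes h k :: "'a::euclidean_space \<Rightarrow> complex"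
  assumes h: "integrable lborel h" and k: "integrable lborel k"
  shows "fourier (conv h k) \<xi> = fourier h \<xi> * fourier k \<xi>"
proof -
  let ?e = "\<lambda>x::'a. exp (- 2 * of_real pi * \<i> * of_real (x \<bullet> \<xi>))"
  have [measurable]: "h \<in> borel_measurable borel" "k \<in> borel_measurable borel"
    using h k by auto
  have "conv h k x * ?e x = conv (\<lambda>x. h x * ?e x) (\<lambda>x. k x * ?e x) x" for x
  proof -
    have "?e x = ?e (x - y) * ?e y" for y
      by (simp add: inner_diff_left algebra_simps flip: exp_add)
    then have "conv h k x * ?e x = (LINT y|lborel. (h (x - y) * k y) * (?e (x - y) * ?e y))"
      by (simp only: conv_lborel[OF \<open>h \<in> _\<close> \<open>k \<in> _\<close>] flip: integral_mult_left_zero)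
    also have "\<dots> = conv (\<lambda>x. h x * ?e x) (\<lambda>x. k x * ?e x) x"
      by (subst conv_lborel) (auto intro!: Bochner_Integration.integral_cong)
    finally show ?thesis .
  qed
  then have "fourier (conv h k) \<xi> = (LINT x|lborel. conv (\<lambda>x. h x * ?e x) (\<lambda>x. k x * ?e x) x)"
    by (subst fourier_lborel) auto
  also have "\<dots> = fourier h \<xi> * fourier k \<xi>"
    by (simp only: integral_conv[OF integrable_fourier_kernel[OF h] integrable_fourier_kernel[OF k]]
        fourier_lborel[OF \<open>h \<in> _\<close>] fourier_lborel[OF \<open>k \<in> _\<close>])
  finally show ?thesis .
qed

text \<open>Together with \<open>integrable_conv\<close> this shows that continuous bounded
  integrable functions form a class stable under convolution with an integrable kernel, so
  \<open>plancherel_continuous\<close> applies to \<open>conv u k\<close>. Continuity is dominated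
  convergence with majorant \<open>M * cmod (k y)\<close>.\<close>

lemma
  fixes u k :: "'a::euclidean_space \<Rightarrow> complex"
  assumes cont: "continuous_on UNIV u" and bdd: "\<And>x. cmod (u x) \<le> M" and k: "integrable lborel k"
  shows continuous_on_conv: "continuous_on UNIV (conv u k)"
    and conv_bounded: "cmod (conv u k x) \<le> M * (LINT y|lborel. cmod (k y))"
proof -
  have [measurable]: "u \<in> borel_measurable borel" "k \<in> borel_measurable borel"
    using k cont by (auto intro: borel_measurable_continuous_onI)
  have int: "integrable lborel (\<lambda>y. M * cmod (k y))" using k by simp
  have le: "cmod (u (x - y) * k y) \<le> M * cmod (k y)" for x y
    by (simp add: norm_mult bdd mult_right_mono)
  have eq: "conv u k = (\<lambda>x. LINT y|lborel. u (x - y) * k y)"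
    by (rule ext, rule conv_lborel) measurable
  have "cmod (LINT y|lborel. u (x - y) * k y) \<le> (LINT y|lborel. cmod (u (x - y) * k y))"
    by (rule integral_norm_bound)
  also have "\<dots> \<le> (LINT y|lborel. M * cmod (k y))"
    by (intro integral_mono_AE'[OF int] AE_I2 le order_trans[OF norm_ge_zero le])
  finally show "cmod (conv u k x) \<le> M * (LINT y|lborel. cmod (k y))"
    by (simp add: eq)
  have "(\<lambda>n. LINT y|lborel. u (s n - y) * k y) \<longlonglongrightarrow> (LINT y|lborel. u (a - y) * k y)"
    if "s \<longlonglongrightarrow> a" for s a
  proof (rule integral_dominated_convergence[OF _ _ int])
    have "(\<lambda>n. u (s n - y)) \<longlonglongrightarrow> u (a - y)" for y
      by (rule continuous_on_tendsto_compose[OF cont]) (auto intro!: tendsto_intros that)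
    then show "AE y in lborel. (\<lambda>n. u (s n - y) * k y) \<longlonglongrightarrow> u (a - y) * k y"
      by (auto intro!: tendsto_intros)
  qed (use le in auto)
  then show "continuous_on UNIV (conv u k)"
    unfolding eq by (intro continuous_on_sequentiallyI)
qed

section \<open>Plancherel by Gaussian regularization\<close>

lemma borel_measurable_fourier [measurable]:
  fixes f :: "'a::euclidean_space \<Rightarrow> complex"
  assumes [measurable]: "f \<in> borel_measurable borel"
  shows "fourier f \<in> borel_measurable borel"
proof -
  have eq: "fourier f = (\<lambda>\<xi>. LINT x|lborel. f x * exp (- 2 * of_real pi * \<i> * of_real (x \<bullet> \<xi>)))"
    by (rule ext, rule fourier_lborel) measurable
  show ?thesis unfolding eq
    by (rule lborel.borel_measurable_lebesgue_integral) measurable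
qed

lemma fourier_bounded:
  fixes f :: "'a::euclidean_space \<Rightarrow> complex"
  assumes f: "integrable lborel f"
  shows "cmod (fourier f \<xi>) \<le> (LINT x|lborel. cmod (f x))"
  using integral_norm_bound[of lborel "\<lambda>x. f x * exp (- 2 * of_real pi * \<i> * of_real (x \<bullet> \<xi>))"] f
  by (simp add: fourier_lborel norm_mult)

text \<open>The multiplication formula: Fubini moves the transform from \<open>f\<close> to the
  Gaussian, which reproduces itself.\<close>

lemma integral_fourier_gauss:
  fixes f :: "'a::euclidean_space \<Rightarrow> complex"
  assumes f: "integrable lborel f"
  shows "(LINT \<xi>|lborel. fourier f \<xi> * of_real (gauss \<xi>)) = (LINT x|lborel. f x * of_real (gauss x))"
proof -
  let ?e = "\<lambda>x \<xi>::'a. exp (- 2 * of_real pi * \<i> * of_real (x \<bullet> \<xi>))"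
  have [measurable]: "f \<in> borel_measurable borel" using f by auto
  have "integrable (lborel \<Otimes>\<^sub>M lborel) (\<lambda>(\<xi>, x). f x * ?e x \<xi> * of_real (gauss \<xi>))"
  proof (rule lborel_pair.Fubini_integrable)
    have "(\<lambda>\<xi>. LINT x|lborel. norm (case (\<xi>, x) of (\<xi>, x) \<Rightarrow> f x * ?e x \<xi> * of_real (gauss \<xi>)))
        = (\<lambda>\<xi>::'a. (LINT x|lborel. norm (f x)) * gauss \<xi>)"
      by (simp add: norm_mult)
    then show "integrable lborel (\<lambda>\<xi>. LINT x|lborel. norm (case (\<xi>, x) of (\<xi>, x) \<Rightarrow> f x * ?e x \<xi> * of_real (gauss \<xi>)))"
      by (simp add: integrable_gauss)
    show "AE \<xi> in lborel. integrable lborel (\<lambda>x. case (\<xi>, x) of (\<xi>, x) \<Rightarrow> f x * ?e x \<xi> * of_real (gauss \<xi>))"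
      using integrable_fourier_kernel[OF f] by simp
  qed measurable
  note fub = lborel_pair.integral_snd[OF this] lborel_pair.integral_fst[OF this]
  have "(LINT \<xi>|lborel. fourier f \<xi> * of_real (gauss \<xi>))
      = (LINT \<xi>|lborel. LINT x|lborel. f x * ?e x \<xi> * of_real (gauss \<xi>))"
    by (simp add: fourier_lborel)
  also have "\<dots> = (LINT x|lborel. LINT \<xi>|lborel. f x * ?e x \<xi> * of_real (gauss \<xi>))"
    using fub by simp
  also have "\<dots> = (LINT x|lborel. f x * of_real (gauss x))"
  proof (rule Bochner_Integration.integral_cong[OF refl])
    fix x :: 'a
    have "(LINT \<xi>|lborel. f x * ?e x \<xi> * of_real (gauss \<xi>))
        = (LINT \<xi>|lborel. f x * (of_real (gauss \<xi>) * ?e \<xi> x))"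
      by (simp only: inner_commute[of x] ac_simps)
    also have "\<dots> = f x * of_real (gauss x)"
      by (simp only: gauss_fourier_lborel(2) integral_mult_right_zero)
    finally show "(LINT \<xi>|lborel. f x * ?e x \<xi> * of_real (gauss \<xi>)) = f x * of_real (gauss x)" .
  qed
  finally show ?thesis .
qed

text \<open>As \<open>r\<close> tends to 0 the left weight tends to 1, while on the right the weight
  stays fixed and the argument of \<open>f\<close> shrinks to the origin. This is Fourier inversion
  at 0 with a Gaussian cutoff.\<close>

lemma integral_fourier_gauss_scaled:
  fixes f :: "'a::euclidean_space \<Rightarrow> complex"
  assumes f: "integrable lborel f" and r: "r > 0"
  shows "(LINT \<xi>|lborel. fourier f \<xi> * of_real (gauss (r *\<^sub>R \<xi>))) = (LINT x|lborel. f (r *\<^sub>R x) * of_real (gauss x))"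
proof -
  let ?e = "\<lambda>x \<xi>::'a. exp (- 2 * of_real pi * \<i> * of_real (x \<bullet> \<xi>))"
  let ?g = "\<lambda>x. f (r *\<^sub>R x)"
  let ?d = "r ^ DIM('a)"
  have [measurable]: "f \<in> borel_measurable borel" using f by auto
  have g: "integrable lborel ?g"
    using lborel_integrable_affine_iff[of f r 0] f r by simp
  have fg: "fourier f \<xi> = ?d *\<^sub>R fourier ?g (r *\<^sub>R \<xi>)" for \<xi>
    using lborel_integral_affine[of "\<lambda>x. f x * ?e x \<xi>" r 0] r
    by (simp add: fourier_lborel ac_simps)
  have "(LINT \<xi>|lborel. fourier f \<xi> * of_real (gauss (r *\<^sub>R \<xi>)))
      = ?d *\<^sub>R (LINT \<xi>|lborel. fourier ?g (r *\<^sub>R \<xi>) * of_real (gauss (r *\<^sub>R \<xi>)))"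
    by (simp add: fg)
  also have "\<dots> = (LINT \<xi>|lborel. fourier ?g \<xi> * of_real (gauss \<xi>))"
    using lborel_integral_affine[of "\<lambda>\<xi>. fourier ?g \<xi> * of_real (gauss \<xi>)" r 0] r by simp
  also have "\<dots> = (LINT x|lborel. f (r *\<^sub>R x) * of_real (gauss x))"
    by (rule integral_fourier_gauss[OF g])
  finally show ?thesis .
qed

text \<open>The squared \<open>L2\<close> norm. Squares in \<open>ennreal\<close> add up over
  families and avoid both roots and finiteness conditions.\<close>

definition energy :: "('a::euclidean_space \<Rightarrow> complex) \<Rightarrow> ennreal" where
  "energy f = (\<integral>\<^sup>+x. ennreal ((cmod (f x))\<^sup>2) \<partial>lborel)"

text \<open>The autocorrelation \<open>a\<close> of \<open>f\<close> has transform equal to the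
  squared modulus of the transform of \<open>f\<close>, and its value at 0 is the energy of
  \<open>f\<close>. Inversion at 0 with a Gaussian cutoff equates the two energies; since the
  transform of \<open>a\<close> is nonnegative, the cutoff can be removed by monotone convergence,
  without knowing beforehand that this transform is integrable.\<close>

lemma plancherel_continuous:
  fixes f :: "'a::euclidean_space \<Rightarrow> complex"
  assumes f: "integrable lborel f" and cont: "continuous_on UNIV f" and bdd: "\<And>x. cmod (f x) \<le> M"
  shows "energy (fourier f) = energy f" "energy f < \<infinity>"
proof -
  have f_meas [measurable]: "f \<in> borel_measurable borel" using f by auto
  define f' where "f' x = cnj (f (- x))" for x
  have f': "integrable lborel f'"
    unfolding f'_def using lborel_integrable_affine_iff[of f "-1" 0] f by simp
  have f'_meas [measurable]: "f' \<in> borel_measurable borel" using f' by auto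
  define a where "a = conv f f'"
  have a: "integrable lborel a" "continuous_on UNIV a" "\<And>x. cmod (a x) \<le> M * (LINT y|lborel. cmod (f' y))"
    unfolding a_def using integrable_conv[OF f f'] continuous_on_conv[OF cont bdd f'] conv_bounded[OF cont bdd f']
    by auto
  have a_meas [measurable]: "a \<in> borel_measurable borel" using a by auto
  have cnj: "cnj \<in> borel_measurable borel"
    by (intro borel_measurable_continuous_onI continuous_intros)
  have fourier_f': "fourier f' \<xi> = cnj (fourier f \<xi>)" for \<xi>
  proof -
    have "fourier f' \<xi> = (LINT x|lborel. cnj (f (- x) * exp (- 2 * of_real pi * \<i> * of_real ((- x) \<bullet> \<xi>))))"
      by (simp add: fourier_lborel f'_def exp_cnj)
    also have "\<dots> = (LINT x|lborel. cnj (f x * exp (- 2 * of_real pi * \<i> * of_real (x \<bullet> \<xi>))))"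
      using lborel_integral_diff(2)[of "\<lambda>x. cnj (f x * exp (- 2 * of_real pi * \<i> * of_real (x \<bullet> \<xi>)))" 0]
      by (simp add: measurable_compose[OF _ cnj] del: complex_cnj_mult)
    also have "\<dots> = cnj (fourier f \<xi>)"
      by (simp only: Bochner_Integration.integral_cnj fourier_lborel[OF f_meas])
    finally show ?thesis .
  qed
  have fourier_a: "fourier a \<xi> = of_real ((cmod (fourier f \<xi>))\<^sup>2)" for \<xi>
    unfolding a_def fourier_conv[OF f f'] fourier_f' by (simp only: complex_norm_square)
  \<comment> \<open>A bounded integrable function is square integrable: one factor is estimated by
    \<open>M\<close>.\<close>
  have sq_int: "integrable lborel (\<lambda>x. (cmod (f x))\<^sup>2)"
  proof (rule Bochner_Integration.integrable_bound)
    show "integrable lborel (\<lambda>x. M * cmod (f x))" using f by simp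
    show "AE x in lborel. norm ((cmod (f x))\<^sup>2) \<le> norm (M * cmod (f x))"
      using bdd by (auto simp: power2_eq_square intro!: mult_right_mono order_trans[OF _ abs_ge_self])
  qed measurable
  then have energy_eq: "energy f = ennreal (LINT x|lborel. (cmod (f x))\<^sup>2)"
    unfolding energy_def by (intro nn_integral_eq_integral) auto
  then show "energy f < \<infinity>" by simp
  have a_0: "a 0 = of_real (LINT x|lborel. (cmod (f x))\<^sup>2)"
  proof -
    have "a 0 = (LINT y|lborel. f (0 - y) * cnj (f (0 - y)))"
      by (simp add: a_def conv_lborel f'_def)
    also have "\<dots> = (LINT y|lborel. f y * cnj (f y))"
      by (rule lborel_integral_diff) (intro borel_measurable_times f_meas measurable_compose[OF f_meas cnj])
    also have "\<dots> = of_real (LINT x|lborel. (cmod (f x))\<^sup>2)"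
      by (subst integral_complex_of_real[symmetric]) (simp only: complex_norm_square)
    finally show ?thesis .
  qed
  define r where "r n = 1 / real (Suc n)" for n
  have r: "r n > 0" for n by (simp add: r_def)
  have r0: "r \<longlonglongrightarrow> 0" unfolding r_def by (rule LIMSEQ_Suc[OF lim_1_over_n])
  have r_dec: "r (Suc n) \<le> r n" for n by (simp add: r_def field_simps)
  let ?b = "\<lambda>n \<xi>. (cmod (fourier f \<xi>))\<^sup>2 * gauss (r n *\<^sub>R \<xi>)"
  have gauss_r: "integrable lborel (\<lambda>\<xi>::'a. gauss (r n *\<^sub>R \<xi>))" for n
    using lborel_integrable_affine_iff[of "gauss :: 'a \<Rightarrow> real" "r n" 0] integrable_gauss[where 'a='a] r[of n] by simp
  have b_int: "integrable lborel (?b n)" for n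
  proof (rule Bochner_Integration.integrable_bound)
    show "integrable lborel (\<lambda>\<xi>::'a. (LINT x|lborel. cmod (f x))\<^sup>2 * gauss (r n *\<^sub>R \<xi>))"
      using gauss_r by simp
    show "AE \<xi> in lborel. norm (?b n \<xi>) \<le> norm ((LINT x|lborel. cmod (f x))\<^sup>2 * gauss (r n *\<^sub>R \<xi>))"
      using fourier_bounded[OF f]
      by (intro AE_I2) (auto simp: abs_mult intro!: mult_right_mono power_mono)
  qed measurable
  \<comment> \<open>The space side: continuity of \<open>a\<close> at the origin gives the pointwise
    limit, boundedness of \<open>a\<close> the Gaussian majorant.\<close>
  have "(\<lambda>n. LINT x|lborel. a (r n *\<^sub>R x) * of_real (gauss x)) \<longlonglongrightarrow> (LINT x|lborel. a 0 * of_real (gauss (x::'a)))"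
  proof (rule integral_dominated_convergence[where w = "\<lambda>x::'a. (M * (LINT y|lborel. cmod (f' y))) * gauss x"])
    show "integrable lborel (\<lambda>x::'a. (M * (LINT y|lborel. cmod (f' y))) * gauss x)"
      by (simp add: integrable_gauss)
    show "AE x in lborel. (\<lambda>n. a (r n *\<^sub>R x) * of_real (gauss x)) \<longlonglongrightarrow> a 0 * of_real (gauss (x::'a))"
      by (intro AE_I2 tendsto_intros continuous_on_tendsto_compose[OF a(2)])
         (auto intro: tendsto_eq_intros r0)
    show "AE x in lborel. norm (a (r n *\<^sub>R x) * of_real (gauss x)) \<le> M * (LINT y|lborel. cmod (f' y)) * gauss x" for n
      using a(3) by (intro AE_I2) (auto simp: norm_mult intro!: mult_right_mono)
  qed measurable
  moreover have "(LINT x|lborel. a (r n *\<^sub>R x) * of_real (gauss x)) = of_real (LINT \<xi>|lborel. ?b n \<xi>)" for n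
    unfolding integral_fourier_gauss_scaled[OF a(1) r, symmetric] fourier_a
    by (simp only: integral_complex_of_real flip: of_real_mult)
  moreover have "(LINT x|lborel. a 0 * of_real (gauss (x::'a))) = of_real (LINT x|lborel. (cmod (f x))\<^sup>2)"
    by (simp add: a_0 integral_gauss)
  ultimately have "(\<lambda>n. LINT \<xi>|lborel. ?b n \<xi>) \<longlonglongrightarrow> (LINT x|lborel. (cmod (f x))\<^sup>2)"
    by (simp add: tendsto_of_real_iff)
  then have "(\<lambda>n. ennreal (LINT \<xi>|lborel. ?b n \<xi>)) \<longlonglongrightarrow> energy f"
    unfolding energy_eq by (rule tendsto_ennrealI)
  moreover have "ennreal (LINT \<xi>|lborel. ?b n \<xi>) = (\<integral>\<^sup>+\<xi>. ennreal (?b n \<xi>) \<partial>lborel)" for n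
    by (intro nn_integral_eq_integral[symmetric] b_int) auto
  ultimately have lim1: "(\<lambda>n. \<integral>\<^sup>+\<xi>. ennreal (?b n \<xi>) \<partial>lborel) \<longlonglongrightarrow> energy f"
    by simp
  \<comment> \<open>The frequency side: smaller \<open>r n\<close> means a wider Gaussian, so the
    regularized integrands increase to the full one.\<close>
  have mono: "?b n \<xi> \<le> ?b (Suc n) \<xi>" for n \<xi>
  proof -
    have "(norm (r (Suc n) *\<^sub>R \<xi>))\<^sup>2 \<le> (norm (r n *\<^sub>R \<xi>))\<^sup>2"
      using r_dec[of n] r[of n] r[of "Suc n"] by (intro power_mono) (auto intro: mult_right_mono)
    then show ?thesis
      by (auto simp: gauss_def intro!: mult_left_mono)
  qed
  have inc: "incseq (\<lambda>n \<xi>. ennreal (?b n \<xi>))"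
    using mono by (auto intro!: incseq_SucI le_funI ennreal_leI)
  have "(SUP n. ennreal (?b n \<xi>)) = ennreal ((cmod (fourier f \<xi>))\<^sup>2)" for \<xi>
  proof (rule LIMSEQ_unique[OF LIMSEQ_SUP])
    show "incseq (\<lambda>n. ennreal (?b n \<xi>))"
      using mono by (auto intro!: incseq_SucI ennreal_leI)
    have "(\<lambda>n. gauss (r n *\<^sub>R \<xi>)) \<longlonglongrightarrow> gauss (0::'a)"
      by (rule continuous_on_tendsto_compose[OF continuous_gauss]) (auto intro: tendsto_eq_intros r0)
    then have "(\<lambda>n. ?b n \<xi>) \<longlonglongrightarrow> (cmod (fourier f \<xi>))\<^sup>2 * 1"
      by (intro tendsto_intros) (simp add: gauss_def)
    then show "(\<lambda>n. ennreal (?b n \<xi>)) \<longlonglongrightarrow> ennreal ((cmod (fourier f \<xi>))\<^sup>2)"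
      by (simp add: tendsto_ennrealI)
  qed
  then have "energy (fourier f) = (\<integral>\<^sup>+\<xi>. (SUP n. ennreal (?b n \<xi>)) \<partial>lborel)"
    by (simp add: energy_def)
  also have "\<dots> = (SUP n. \<integral>\<^sup>+\<xi>. ennreal (?b n \<xi>) \<partial>lborel)"
    by (rule nn_integral_monotone_convergence_SUP[OF inc]) measurable
  also have "\<dots> = energy f"
  proof (rule LIMSEQ_unique[OF LIMSEQ_SUP lim1])
    show "incseq (\<lambda>n. \<integral>\<^sup>+\<xi>. ennreal (?b n \<xi>) \<partial>lborel)"
      using mono by (auto intro!: incseq_SucI nn_integral_mono ennreal_leI)
  qed
  finally show "energy (fourier f) = energy f" .
qed

section \<open>Young inequality and approximation in the mean\<close>

lemma energy_cong_AE: "(AE x in lborel. f x = g x) \<Longrightarrow> energy f = energy g"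
  unfolding energy_def by (rule nn_integral_cong_AE) auto

text \<open>Cauchy-Schwarz after splitting \<open>cmod (k y)\<close> into two equal square roots,
  then Tonelli. The modulus stands inside the inner integral so that the bound also yields absolute
  convergence almost everywhere.\<close>

lemma nn_integral_conv_sqr:
  fixes h k :: "'a::euclidean_space \<Rightarrow> complex"
  assumes [measurable]: "h \<in> borel_measurable borel" and k: "integrable lborel k"
  shows "(\<integral>\<^sup>+x. (\<integral>\<^sup>+y. ennreal (cmod (h (x - y) * k y)) \<partial>lborel)\<^sup>2 \<partial>lborel)
    \<le> ennreal ((LINT y|lborel. cmod (k y))\<^sup>2) * energy h"
proof -
  have [measurable]: "k \<in> borel_measurable borel" using k by auto
  define K where "K = ennreal (LINT y|lborel. cmod (k y))"
  have K: "(\<integral>\<^sup>+y. ennreal (cmod (k y)) \<partial>lborel) = K"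
    unfolding K_def using k by (intro nn_integral_eq_integral) auto
  have "(\<integral>\<^sup>+y. ennreal (cmod (h (x - y) * k y)) \<partial>lborel)\<^sup>2
      \<le> K * (\<integral>\<^sup>+y. ennreal ((cmod (h (x - y)))\<^sup>2) * ennreal (cmod (k y)) \<partial>lborel)" for x
  proof -
    let ?s = "\<lambda>y. ennreal (sqrt (cmod (k y)))"
    have s: "?s y * ?s y = ennreal (cmod (k y))" for y
      by (simp flip: ennreal_mult)
    have "(\<integral>\<^sup>+y. ennreal (cmod (h (x - y) * k y)) \<partial>lborel)
        = (\<integral>\<^sup>+y. ?s y * (?s y * ennreal (cmod (h (x - y)))) \<partial>lborel)"
      by (simp only: mult.assoc[symmetric] s) (simp add: norm_mult ennreal_mult ac_simps)
    also have "\<dots>\<^sup>2 \<le> (\<integral>\<^sup>+y. (?s y)\<^sup>2 \<partial>lborel) * (\<integral>\<^sup>+y. (?s y * ennreal (cmod (h (x - y))))\<^sup>2 \<partial>lborel)"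
      by (rule Cauchy_Schwarz_nn_integral) measurable
    also have "\<dots> = K * (\<integral>\<^sup>+y. ennreal ((cmod (h (x - y)))\<^sup>2) * ennreal (cmod (k y)) \<partial>lborel)"
      by (simp add: power_mult_distrib power2_eq_square s K ennreal_mult ac_simps)
         (simp add: mult.assoc[symmetric] s)
    finally show ?thesis .
  qed
  then have "(\<integral>\<^sup>+x. (\<integral>\<^sup>+y. ennreal (cmod (h (x - y) * k y)) \<partial>lborel)\<^sup>2 \<partial>lborel)
     \<le> (\<integral>\<^sup>+x. K * (\<integral>\<^sup>+y. ennreal ((cmod (h (x - y)))\<^sup>2) * ennreal (cmod (k y)) \<partial>lborel) \<partial>lborel)"
    by (intro nn_integral_mono)
  also have "\<dots> = K * (\<integral>\<^sup>+x. (\<integral>\<^sup>+y. ennreal ((cmod (h (x - y)))\<^sup>2) * ennreal (cmod (k y)) \<partial>lborel) \<partial>lborel)"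
    by (rule nn_integral_cmult) measurable
  also have "(\<integral>\<^sup>+x. (\<integral>\<^sup>+y. ennreal ((cmod (h (x - y)))\<^sup>2) * ennreal (cmod (k y)) \<partial>lborel) \<partial>lborel)
     = (\<integral>\<^sup>+y. (\<integral>\<^sup>+x. ennreal ((cmod (h (x - y)))\<^sup>2) * ennreal (cmod (k y)) \<partial>lborel) \<partial>lborel)"
    by (rule lborel_pair.Fubini') measurable
  also have "\<dots> = (\<integral>\<^sup>+y. energy h * ennreal (cmod (k y)) \<partial>lborel)"
    by (simp add: nn_integral_multc energy_def nn_integral_lborel_diff(1)[of "\<lambda>x. ennreal ((cmod (h x))\<^sup>2)"])
  also have "\<dots> = energy h * K"
    by (simp add: nn_integral_cmult K)
  finally show ?thesis
    by (simp add: K_def ac_simps power2_eq_square ennreal_mult integral_nonneg_AE)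
qed

lemma energy_conv_le:
  fixes h k :: "'a::euclidean_space \<Rightarrow> complex"
  assumes h [measurable]: "h \<in> borel_measurable borel" and k: "integrable lborel k"
  shows "energy (conv h k) \<le> ennreal ((LINT y|lborel. cmod (k y))\<^sup>2) * energy h"
proof -
  have [measurable]: "k \<in> borel_measurable borel" using k by auto
  have "ennreal ((cmod (conv h k x))\<^sup>2) \<le> (\<integral>\<^sup>+y. ennreal (cmod (h (x - y) * k y)) \<partial>lborel)\<^sup>2" for x
  proof -
    have "ennreal (cmod (conv h k x)) \<le> (\<integral>\<^sup>+y. ennreal (cmod (h (x - y) * k y)) \<partial>lborel)"
      unfolding conv_lborel[OF h \<open>k \<in> _\<close>]
      \<comment> \<open>Where the integrand is not integrable, the left side is the default value
        0.\<close>
      by (cases "integrable lborel (\<lambda>y. h (x - y) * k y)")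
         (auto simp: not_integrable_integral_eq intro: integral_norm_bound_ennreal)
    from power_mono[OF this, of 2] show ?thesis by (simp add: ennreal_power)
  qed
  then show ?thesis
    unfolding energy_def[of "conv h k"]
    by (intro order_trans[OF nn_integral_mono nn_integral_conv_sqr[OF assms]])
qed

text \<open>A function with finite integral is finite almost everywhere. This is what allows
  \<open>conv (h - u) k\<close> to be split, since Bochner integrals may be subtracted only where
  both exist.\<close>

lemma AE_integrable_conv:
  fixes h k :: "'a::euclidean_space \<Rightarrow> complex"
  assumes h [measurable]: "h \<in> borel_measurable borel" and E: "energy h < \<infinity>" and k: "integrable lborel k"
  shows "AE x in lborel. integrable lborel (\<lambda>y. h (x - y) * k y)"
proof -
  have [measurable]: "k \<in> borel_measurable borel" using k by auto
  have "(\<integral>\<^sup>+x. (\<integral>\<^sup>+y. ennreal (cmod (h (x - y) * k y)) \<partial>lborel)\<^sup>2 \<partial>lborel) < \<infinity>"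
    by (rule order.strict_trans1[OF nn_integral_conv_sqr[OF h k]])
       (use E in \<open>simp add: ennreal_mult_less_top\<close>)
  then have "AE x in lborel. (\<integral>\<^sup>+y. ennreal (cmod (h (x - y) * k y)) \<partial>lborel)\<^sup>2 \<noteq> \<infinity>"
    by (intro nn_integral_PInf_AE) auto
  then show ?thesis
    by eventually_elim (auto simp: integrable_iff_bounded less_top[symmetric] power_eq_top_ennreal)
qed

text \<open>A triangle inequality for squares, from expanding
  \<open>(t * a - b)\<^sup>2 / t\<close>, which is nonnegative. Small \<open>t\<close> makes the
  factor of the main term close to 1, at the price of a large but finite factor on the
  error.\<close>

lemma energy_triangle:
  fixes f g :: "'a::euclidean_space \<Rightarrow> complex"
  assumes [measurable]: "f \<in> borel_measurable borel" "g \<in> borel_measurable borel"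
    and le: "AE x in lborel. cmod (f x) \<le> cmod (g x) + cmod (d x)" and [measurable]: "d \<in> borel_measurable borel"
    and t: "t > 0"
  shows "energy f \<le> ennreal (1 + t) * energy g + ennreal (1 + 1 / t) * energy d"
proof -
  have sqr: "(a + b)\<^sup>2 \<le> (1 + t) * a\<^sup>2 + (1 + 1 / t) * b\<^sup>2" for a b :: real
  proof -
    have "0 \<le> (t * a - b)\<^sup>2 / t" using t by simp
    also have "\<dots> = (1 + t) * a\<^sup>2 + (1 + 1 / t) * b\<^sup>2 - (a + b)\<^sup>2"
      using t by (simp add: field_simps power2_eq_square)
    finally show ?thesis by simp
  qed
  have "AE x in lborel. ennreal ((cmod (f x))\<^sup>2)
      \<le> ennreal (1 + t) * ennreal ((cmod (g x))\<^sup>2) + ennreal (1 + 1 / t) * ennreal ((cmod (d x))\<^sup>2)"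
    using le
  proof eventually_elim
    case (elim x)
    then have "(cmod (f x))\<^sup>2 \<le> (1 + t) * (cmod (g x))\<^sup>2 + (1 + 1 / t) * (cmod (d x))\<^sup>2"
      by (intro order_trans[OF power_mono sqr]) auto
    then show ?case
      using t by (simp flip: ennreal_mult ennreal_plus)
  qed
  then have "energy f \<le> (\<integral>\<^sup>+x. ennreal (1 + t) * ennreal ((cmod (g x))\<^sup>2) + ennreal (1 + 1 / t) * ennreal ((cmod (d x))\<^sup>2) \<partial>lborel)"
    unfolding energy_def by (rule nn_integral_mono_AE)
  also have "\<dots> = ennreal (1 + t) * energy g + ennreal (1 + 1 / t) * energy d"
    unfolding energy_def by (simp add: nn_integral_add nn_integral_cmult)
  finally show ?thesis .
qed

text \<open>Radial retraction onto the disc of radius \<open>r\<close>, written with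
  \<open>max\<close> so that for positive radius it is visibly continuous in the radius and the
  point jointly.\<close>

definition clamp_norm :: "real \<Rightarrow> complex \<Rightarrow> complex" where
  "clamp_norm r z = (r / max r (cmod z)) *\<^sub>R z"

lemma norm_clamp_norm:
  assumes "r > 0" shows "cmod (clamp_norm r z) \<le> r" "cmod (clamp_norm r z) \<le> cmod z"
  using assms by (auto simp: clamp_norm_def max_def field_simps)

lemma clamp_norm_id: "r > 0 \<Longrightarrow> cmod z \<le> r \<Longrightarrow> clamp_norm r z = z"
  by (simp add: clamp_norm_def max_def)

lemma continuous_on_clamp_norm [continuous_intros]:
  assumes "continuous_on S r" "continuous_on S f" "\<And>x. x \<in> S \<Longrightarrow> r x > 0"
  shows "continuous_on S (\<lambda>x. clamp_norm (r x) (f x))"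
proof -
  have "max (r x) (cmod (f x)) \<noteq> 0" if "x \<in> S" for x
    using assms(3)[OF that] by (auto simp: max_def)
  then show ?thesis
    unfolding clamp_norm_def using assms(1,2) by (intro continuous_intros) auto
qed

lemma borel_measurable_clamp_norm [measurable]:
  assumes [measurable]: "r \<in> borel_measurable M" "f \<in> borel_measurable M"
  shows "(\<lambda>x. clamp_norm (r x) (f x)) \<in> borel_measurable M"
  unfolding clamp_norm_def by measurable

lemma tendsto_energy_dominated:
  fixes f :: "'a::euclidean_space \<Rightarrow> complex"
  assumes [measurable]: "f \<in> borel_measurable borel" "\<And>n. u n \<in> borel_measurable borel" "w \<in> borel_measurable borel"
    and lim: "AE x in lborel. (\<lambda>n. u n x) \<longlonglongrightarrow> f x"
    and le: "\<And>n x. cmod (f x - u n x) \<le> w x" and w: "(\<integral>\<^sup>+x. ennreal ((w x)\<^sup>2) \<partial>lborel) < \<infinity>"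
  shows "(\<lambda>n. energy (\<lambda>x. f x - u n x)) \<longlonglongrightarrow> 0"
proof -
  have "(\<lambda>n. energy (\<lambda>x. f x - u n x)) \<longlonglongrightarrow> (\<integral>\<^sup>+x. 0 \<partial>(lborel :: 'a measure))"
    unfolding energy_def
  proof (rule nn_integral_dominated_convergence[where w = "\<lambda>x. ennreal ((w x)\<^sup>2)"])
    show "AE x in lborel. ennreal ((cmod (f x - u n x))\<^sup>2) \<le> ennreal ((w x)\<^sup>2)" for n
      using le by (intro AE_I2 ennreal_leI power_mono) auto
    show "AE x in lborel. (\<lambda>n. ennreal ((cmod (f x - u n x))\<^sup>2)) \<longlonglongrightarrow> 0"
      using lim
    proof eventually_elim
      case (elim x)
      then have "(\<lambda>n. (cmod (f x - u n x))\<^sup>2) \<longlonglongrightarrow> (cmod (f x - f x))\<^sup>2"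
        by (intro tendsto_intros)
      then show ?case using tendsto_ennrealI by fastforce
    qed
  qed (use w in measurable)
  then show ?thesis by simp
qed

text \<open>Clamp \<open>f\<close> at a multiple of the Gaussian, then replace \<open>f\<close>
  under the same clamp by continuous functions converging to it almost everywhere. The clamp alone
  makes the approximants bounded and integrable and supplies the square integrable majorant for the
  second limit.\<close>

lemma exists_continuous_energy_approx:
  fixes f :: "'a::euclidean_space \<Rightarrow> complex"
  assumes f [measurable]: "f \<in> borel_measurable borel" and E: "energy f < \<infinity>" and \<epsilon>: "\<epsilon> > 0"
  obtains u M where "integrable lborel u" "continuous_on UNIV u" "\<And>x. cmod (u x) \<le> M"
    "energy (\<lambda>x. f x - u x) \<le> \<epsilon>"
proof -
  \<comment> \<open>The height is positive at every point, so each value of \<open>f\<close> is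
    eventually left unchanged by the clamp, and it is continuous, bounded and integrable for each
    \<open>m\<close>.\<close>
  define r where "r m x = real (Suc m) * gauss x" for m and x :: 'a
  have r: "r m x > 0" for m x by (simp add: r_def gauss_pos)
  have r_cont: "continuous_on UNIV (r m)" for m
    unfolding r_def by (intro continuous_intros continuous_on_compose2[OF continuous_gauss]) auto
  have [measurable]: "r m \<in> borel_measurable borel" for m
    unfolding r_def by measurable
  have r_int: "integrable lborel (r m)" for m
    unfolding r_def by (simp add: integrable_gauss)
  have r_le: "r m x \<le> real (Suc m)" for m x
    using gauss_le_1[of x] by (simp add: r_def mult_left_le)
  define v where "v m x = clamp_norm (r m x) (f x)" for m x
  have [measurable]: "v m \<in> borel_measurable borel" for m
    unfolding v_def by measurable
  have "(\<lambda>m. energy (\<lambda>x. f x - v m x)) \<longlonglongrightarrow> 0"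
  proof (rule tendsto_energy_dominated)
    have "eventually (\<lambda>m. v m x = f x) sequentially" for x
    proof -
      obtain m where m: "cmod (f x) / gauss x \<le> real m" using real_arch_simple by blast
      have "v n x = f x" if "n \<ge> m" for n
      proof -
        have "cmod (f x) / gauss x \<le> real (Suc n)" using m that by simp
        then show ?thesis
          unfolding v_def by (intro clamp_norm_id r) (simp add: r_def gauss_pos field_simps)
      qed
      then show ?thesis by (auto simp: eventually_sequentially)
    qed
    then show "AE x in lborel. (\<lambda>m. v m x) \<longlonglongrightarrow> f x"
      by (simp add: tendsto_eventually)
    show "cmod (f x - v m x) \<le> 2 * cmod (f x)" for m x
      using norm_triangle_ineq4[of "f x" "v m x"] norm_clamp_norm(2)[OF r, of m x "f x"] by (simp add: v_def)
    show "(\<integral>\<^sup>+x. ennreal ((2 * cmod (f x))\<^sup>2) \<partial>lborel) < \<infinity>"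
      using E by (simp add: power_mult_distrib ennreal_mult nn_integral_cmult ennreal_mult_less_top energy_def)
  qed measurable
  \<comment> \<open>Each of the two errors gets a quarter: combining them with \<open>t = 1\<close>
    doubles both.\<close>
  moreover have "\<epsilon> / 4 > 0" using \<epsilon> by (simp add: ennreal_zero_less_divide)
  ultimately have "eventually (\<lambda>m. energy (\<lambda>x. f x - v m x) < \<epsilon> / 4) sequentially"
    by (rule order_tendstoD)
  then obtain m where m: "energy (\<lambda>x. f x - v m x) < \<epsilon> / 4"
    by (auto simp: eventually_sequentially)
  \<comment> \<open>Being \<open>measurable_on\<close> is by definition being a limit of continuous
    functions off a negligible set.\<close>
  have "f measurable_on UNIV"
    by (rule lebesgue_measurable_imp_measurable_on) (auto intro: measurable_completion)
  then obtain N g where N: "negligible N" and g: "\<And>n. continuous_on UNIV (g n :: 'a \<Rightarrow> complex)"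
    and lim: "\<And>x. x \<notin> N \<Longrightarrow> (\<lambda>n. g n x) \<longlonglongrightarrow> f x"
    by (auto simp: measurable_on_def)
  define u where "u n x = clamp_norm (r m x) (g n x)" for n x
  have u_cont: "continuous_on UNIV (u n)" for n
    unfolding u_def by (intro continuous_intros r_cont g r)
  have u_meas [measurable]: "u n \<in> borel_measurable borel" for n
    by (rule borel_measurable_continuous_onI[OF u_cont])
  have "(\<lambda>n. energy (\<lambda>x. v m x - u n x)) \<longlonglongrightarrow> 0"
  proof (rule tendsto_energy_dominated)
    have "AE x in lborel. x \<notin> N"
      using AE_not_in[of N lebesgue] N by (simp only: negligible_iff_null_sets AE_completion_iff)
    then show "AE x in lborel. (\<lambda>n. u n x) \<longlonglongrightarrow> v m x"
    proof eventually_elim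
      case (elim x)
      have "continuous_on UNIV (clamp_norm (r m x))"
        using continuous_on_clamp_norm[of UNIV "\<lambda>_. r m x" "\<lambda>z. z"] r by (simp add: continuous_intros)
      from continuous_on_tendsto_compose[OF this lim[OF elim]]
      show ?case by (simp add: u_def v_def)
    qed
    show "cmod (v m x - u n x) \<le> 2 * r m x" for n x
      using norm_triangle_ineq4[of "v m x" "u n x"] norm_clamp_norm(1)[OF r, of m x "f x"]
        norm_clamp_norm(1)[OF r, of m x "g n x"]
      by (simp add: v_def u_def)
    have "integrable lborel (\<lambda>x. (2 * r m x)\<^sup>2)"
    proof (rule Bochner_Integration.integrable_bound)
      show "integrable lborel (\<lambda>x. 4 * real (Suc m) * r m x)" using r_int by simp
      show "AE x in lborel. norm ((2 * r m x)\<^sup>2) \<le> norm (4 * real (Suc m) * r m x)"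
      proof (rule AE_I2)
        fix x
        show "norm ((2 * r m x)\<^sup>2) \<le> norm (4 * real (Suc m) * r m x)"
          using mult_right_mono[OF r_le[of m x] less_imp_le[OF r[of m x]]] less_imp_le[OF r[of m x]]
          by (simp add: power2_eq_square algebra_simps)
      qed
    qed measurable
    then show "(\<integral>\<^sup>+x. ennreal ((2 * r m x)\<^sup>2) \<partial>lborel) < \<infinity>"
      by (simp add: nn_integral_eq_integral)
  qed measurable
  moreover have "\<epsilon> / 4 > 0" using \<epsilon> by (simp add: ennreal_zero_less_divide)
  ultimately have "eventually (\<lambda>n. energy (\<lambda>x. v m x - u n x) < \<epsilon> / 4) sequentially"
    by (rule order_tendstoD)
  then obtain n where n: "energy (\<lambda>x. v m x - u n x) < \<epsilon> / 4"
    by (auto simp: eventually_sequentially)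
  show ?thesis
  proof
    show "integrable lborel (u n)"
      by (rule Bochner_Integration.integrable_bound[OF r_int[of m]])
         (auto simp: u_def intro!: AE_I2 order_trans[OF norm_clamp_norm(1)[OF r]])
    show "continuous_on UNIV (u n)" by (rule u_cont)
    show "cmod (u n x) \<le> real (Suc m)" for x
      unfolding u_def using norm_clamp_norm(1)[OF r] r_le by (rule order_trans)
    have "energy (\<lambda>x. f x - u n x) \<le> ennreal (1 + 1) * energy (\<lambda>x. f x - v m x) + ennreal (1 + 1 / 1) * energy (\<lambda>x. v m x - u n x)"
    proof (rule energy_triangle)
      show "AE x in lborel. cmod (f x - u n x) \<le> cmod (f x - v m x) + cmod (v m x - u n x)"
        by (intro AE_I2) (rule norm_diff_triangle_ineq[of "f _" "v m _", simplified] norm_triangle_sub order_trans[OF _ norm_triangle_ineq]; simp)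
    qed auto
    also have "\<dots> \<le> 2 * (\<epsilon> / 4) + 2 * (\<epsilon> / 4)"
      using m n by (intro add_mono mult_mono) auto
    also have "2 * (\<epsilon> / 4) + 2 * (\<epsilon> / 4) = 4 * (\<epsilon> / 4)"
      by (simp only: distrib_right[symmetric]) simp
    also have "\<dots> = \<epsilon>"
      using mult_divide_eq_ennreal[of 4 \<epsilon>] by (simp only: ennreal_times_divide mult.commute) simp
    finally show "energy (\<lambda>x. f x - u n x) \<le> \<epsilon>" .
  qed
qed

section \<open>Multiplier bounds\<close>

text \<open>Two limits in this order: for fixed \<open>t\<close> the finite constant
  \<open>C t\<close>, which may blow up as \<open>t\<close> tends to 0, is removed by letting
  \<open>e\<close> tend to 0; then \<open>t\<close> tends to 0. The factor is squared because the
  weighted triangle inequality is used twice, from \<open>h\<close> to its approximation and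
  back.\<close>

lemma ennreal_le_perturb:
  fixes a b :: ennreal
  assumes le: "\<And>t e. t > 0 \<Longrightarrow> e > 0 \<Longrightarrow> a \<le> ennreal ((1 + t)\<^sup>2) * b + C t * ennreal e"
    and C: "\<And>t::real. C t < top"
  shows "a \<le> b"
proof -
  define r where "r n = 1 / real (Suc n)" for n
  have r: "r n > 0" for n by (simp add: r_def)
  have r0: "r \<longlonglongrightarrow> 0" unfolding r_def by (rule LIMSEQ_Suc[OF lim_1_over_n])
  have le1: "a \<le> ennreal ((1 + t)\<^sup>2) * b" if "t > 0" for t
  proof (rule LIMSEQ_le_const)
    have "(\<lambda>n. ennreal ((1 + t)\<^sup>2) * b + C t * ennreal (r n)) \<longlonglongrightarrow> ennreal ((1 + t)\<^sup>2) * b + C t * ennreal 0"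
      by (intro tendsto_add tendsto_const ennreal_tendsto_cmult C tendsto_ennrealI r0)
    then show "(\<lambda>n. ennreal ((1 + t)\<^sup>2) * b + C t * ennreal (r n)) \<longlonglongrightarrow> ennreal ((1 + t)\<^sup>2) * b"
      by simp
  qed (use le[OF that r] in blast)
  show ?thesis
  proof (cases "b = top")
    case False
    show ?thesis
    proof (rule LIMSEQ_le_const)
      have "(\<lambda>n. (1 + r n)\<^sup>2) \<longlonglongrightarrow> (1 + 0)\<^sup>2"
        by (intro tendsto_intros r0)
      then have "(\<lambda>n. b * ennreal ((1 + r n)\<^sup>2)) \<longlonglongrightarrow> b * ennreal 1"
        using False by (intro ennreal_tendsto_cmult tendsto_ennrealI) (simp_all add: less_top)
      then show "(\<lambda>n. ennreal ((1 + r n)\<^sup>2) * b) \<longlonglongrightarrow> b"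
        by (simp add: mult.commute)
    qed (use le1[OF r] in blast)
  qed simp
qed

lemma AE_conv_diff:
  fixes h u k :: "'a::euclidean_space \<Rightarrow> complex"
  assumes h: "h \<in> borel_measurable borel" "energy h < \<infinity>"
    and u: "u \<in> borel_measurable borel" "energy u < \<infinity>" and k: "integrable lborel k"
  shows "AE x in lborel. conv (\<lambda>x. h x - u x) k x = conv h k x - conv u k x"
  using AE_integrable_conv[OF h k] AE_integrable_conv[OF u k]
proof eventually_elim
  case (elim x)
  have [measurable]: "h \<in> borel_measurable borel" "u \<in> borel_measurable borel" "k \<in> borel_measurable borel"
    using h u k by auto
  show ?case
    using elim by (simp add: conv_lborel left_diff_distrib)
qed

lemma energy_conv_diff_le:
  fixes h u k :: "'a::euclidean_space \<Rightarrow> complex"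
  assumes h: "h \<in> borel_measurable borel" "energy h < \<infinity>"
    and u: "u \<in> borel_measurable borel" "energy u < \<infinity>" and k: "integrable lborel k"
  shows "energy (\<lambda>x. conv h k x - conv u k x) \<le> ennreal ((LINT y|lborel. cmod (k y))\<^sup>2) * energy (\<lambda>x. h x - u x)"
proof -
  have [measurable]: "h \<in> borel_measurable borel" "u \<in> borel_measurable borel"
    using h u by auto
  have "energy (\<lambda>x. conv h k x - conv u k x) = energy (conv (\<lambda>x. h x - u x) k)"
    using AE_conv_diff[OF assms] by (intro energy_cong_AE) (auto elim: eventually_mono)
  then show ?thesis
    using energy_conv_le[of "\<lambda>x. h x - u x" k] k by simp
qed

lemma energy_conv_continuous:
  fixes u k :: "'a::euclidean_space \<Rightarrow> complex"
  assumes u: "integrable lborel u" "continuous_on UNIV u" "\<And>x. cmod (u x) \<le> M" and k: "integrable lborel k"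
  shows "energy (conv u k) = (\<integral>\<^sup>+\<xi>. ennreal ((cmod (fourier u \<xi>))\<^sup>2) * ennreal ((cmod (fourier k \<xi>))\<^sup>2) \<partial>lborel)"
proof -
  have "energy (conv u k) = energy (fourier (conv u k))"
    by (rule plancherel_continuous(1)[OF integrable_conv[OF u(1) k] continuous_on_conv[OF u(2,3) k]
          conv_bounded[OF u(2,3) k], symmetric])
  then show ?thesis
    by (simp add: energy_def fourier_conv[OF u(1) k] norm_mult power_mult_distrib ennreal_mult)
qed

text \<open>For a continuous bounded integrable \<open>u\<close>, Plancherel turns the left side
  into the integral of the squared transform of \<open>u\<close> times the Bessel sum, which is at
  most \<open>energy u\<close>. The rest transfers this to \<open>h\<close>.\<close>

lemma sum_energy_conv_le:
  fixes k :: "'i \<Rightarrow> 'a::euclidean_space \<Rightarrow> complex"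
  assumes I: "finite I" and k: "\<And>i. i \<in> I \<Longrightarrow> integrable lborel (k i)"
    and bessel: "\<And>\<xi>. (\<Sum>i\<in>I. ennreal ((cmod (fourier (k i) \<xi>))\<^sup>2)) \<le> 1"
    and h: "h \<in> borel_measurable borel" "energy h < \<infinity>"
  shows "(\<Sum>i\<in>I. energy (conv h (k i))) \<le> energy h"
proof -
  define K where "K i = ennreal ((LINT y|lborel. cmod (k i y))\<^sup>2)" for i
  \<comment> \<open>The first summand is the error of replacing \<open>energy u\<close> by
    \<open>energy h\<close>, the second comes from applying Young's inequality to
    \<open>h - u\<close> for each kernel; finiteness of \<open>I\<close> keeps it finite.\<close>
  define C where "C t = ennreal (1 + t) * ennreal (1 + 1 / t) + ennreal (1 + 1 / t) * (\<Sum>i\<in>I. K i)" for t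
  have [measurable]: "h \<in> borel_measurable borel" by fact
  have k_meas [measurable]: "k i \<in> borel_measurable borel" if "i \<in> I" for i
    using k[OF that] by auto
  show ?thesis
  proof (rule ennreal_le_perturb[where C = C])
    show "C t < top" for t
      by (simp add: C_def K_def ennreal_mult_less_top)
  next
    fix t e :: real assume t: "t > 0" and e: "e > 0"
    define p where "p = ennreal (1 + t)"
    define q where "q = ennreal (1 + 1 / t)"
    have pp: "ennreal ((1 + t)\<^sup>2) = p * p"
      using t by (simp add: p_def power2_eq_square ennreal_mult)
    note triangle = energy_triangle[where t = t, OF _ _ _ _ t, folded p_def q_def]
    obtain u M where u: "integrable lborel u" "continuous_on UNIV u" "\<And>x. cmod (u x) \<le> M"
      and hu: "energy (\<lambda>x. h x - u x) \<le> ennreal e"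
      using exists_continuous_energy_approx[OF h, of "ennreal e"] e by auto
    have u_meas [measurable]: "u \<in> borel_measurable borel" using u by auto
    have Eu: "energy u < \<infinity>" by (rule plancherel_continuous(2)[OF u])
    have "energy (conv h (k i)) \<le> p * energy (conv u (k i)) + q * (K i * ennreal e)"
      if i: "i \<in> I" for i
    proof -
      have "energy (conv h (k i)) \<le> p * energy (conv u (k i))
          + q * energy (\<lambda>x. conv h (k i) x - conv u (k i) x)"
        using i by (intro triangle AE_I2 norm_triangle_sub) measurable
      also have "\<dots> \<le> p * energy (conv u (k i)) + q * (K i * ennreal e)"
        unfolding K_def
        by (intro add_left_mono mult_left_mono order_trans[OF energy_conv_diff_le[OF h u_meas Eu k[OF i]]] hu) simp_all
      finally show ?thesis .
    qed
    then have "(\<Sum>i\<in>I. energy (conv h (k i)))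
        \<le> (\<Sum>i\<in>I. p * energy (conv u (k i)) + q * (K i * ennreal e))"
      by (rule sum_mono)
    also have "\<dots> = p * (\<Sum>i\<in>I. energy (conv u (k i))) + q * (\<Sum>i\<in>I. K i) * ennreal e"
      by (simp add: sum.distrib sum_distrib_left sum_distrib_right ac_simps)
    also have "\<dots> \<le> p * (p * energy h + q * ennreal e) + q * (\<Sum>i\<in>I. K i) * ennreal e"
    proof (intro add_right_mono mult_left_mono)
      have "(\<Sum>i\<in>I. energy (conv u (k i)))
          = (\<integral>\<^sup>+\<xi>. (\<Sum>i\<in>I. ennreal ((cmod (fourier u \<xi>))\<^sup>2) * ennreal ((cmod (fourier (k i) \<xi>))\<^sup>2)) \<partial>lborel)"
        by (subst nn_integral_sum) (auto intro!: sum.cong energy_conv_continuous[OF u k])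
      also have "\<dots> \<le> (\<integral>\<^sup>+\<xi>. ennreal ((cmod (fourier u \<xi>))\<^sup>2) \<partial>lborel)"
        using mult_left_mono[OF bessel] by (intro nn_integral_mono) (simp flip: sum_distrib_left)
      also have "\<dots> = energy u"
        using plancherel_continuous(1)[OF u] by (simp add: energy_def)
      \<comment> \<open>The second use of the triangle inequality, now back from \<open>u\<close> to
        \<open>h\<close>.\<close>
      also have "energy u \<le> p * energy h + q * energy (\<lambda>x. h x - u x)"
        by (intro triangle AE_I2 norm_triangle_sub[of "u _" "h _", unfolded norm_minus_commute[of "u _"]]) measurable
      also have "\<dots> \<le> p * energy h + q * ennreal e"
        using hu by (intro add_left_mono mult_left_mono) auto
      finally show "(\<Sum>i\<in>I. energy (conv u (k i))) \<le> p * energy h + q * ennreal e" .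
    qed simp
    finally show "(\<Sum>i\<in>I. energy (conv h (k i))) \<le> ennreal ((1 + t)\<^sup>2) * energy h + C t * ennreal e"
      by (simp only: C_def pp p_def[symmetric] q_def[symmetric]) (simp only: distrib_left distrib_right ac_simps)
  qed
qed

section \<open>Translations as Fourier multipliers\<close>

lemma energy_translate:
  fixes f :: "'a::euclidean_space \<Rightarrow> complex"
  assumes [measurable]: "f \<in> borel_measurable borel"
  shows "energy (translate c f) = energy f"
  using nn_integral_lborel_diff(1)[of "\<lambda>x. ennreal ((cmod (f x))\<^sup>2)" c]
  by (simp add: energy_def translate_def)

lemma fourier_translate:
  fixes f :: "'a::euclidean_space \<Rightarrow> complex"
  assumes [measurable]: "f \<in> borel_measurable borel"
  shows "fourier (translate c f) \<xi> = exp (- 2 * of_real pi * \<i> * of_real (c \<bullet> \<xi>)) * fourier f \<xi>"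
proof -
  let ?e = "\<lambda>x. exp (- 2 * of_real pi * \<i> * of_real (x \<bullet> \<xi>))"
  have "?e c * ?e (x - c) = ?e x" for x
    by (simp add: inner_diff_left algebra_simps flip: exp_add)
  then have eq: "f (x - c) * ?e x = ?e c * (f (x - c) * ?e (x - c))" for x
    by (metis mult.left_commute)
  have "fourier (translate c f) \<xi> = (LINT x|lborel. f (x - c) * ?e x)"
    by (subst fourier_lborel) (simp_all add: translate_def)
  also have "\<dots> = (LINT x|lborel. ?e c * (f (x - c) * ?e (x - c)))"
    by (rule Bochner_Integration.integral_cong[OF refl eq])
  also have "\<dots> = ?e c * (LINT x|lborel. f x * ?e x)"
    by (subst integral_mult_right_zero, subst lborel_integral_diff(1)) auto
  finally show ?thesis by (simp only: fourier_lborel[OF assms])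
qed

text \<open>The Taylor remainder of order zero of the imaginary exponential. The factor
  \<open>2 * pi\<close> of the final constant originates here.\<close>

lemma norm_1_minus_exp_le: "cmod (1 - exp (- 2 * of_real pi * \<i> * of_real s)) \<le> 2 * pi * \<bar>s\<bar>"
proof -
  have "1 - exp (- 2 * of_real pi * \<i> * of_real s) = - (iexp (- 2 * pi * s) - (\<Sum>k\<le>0. (\<i> * of_real (- 2 * pi * s)) ^ k / fact k))"
    by (simp add: algebra_simps)
  also have "cmod \<dots> \<le> \<bar>- 2 * pi * s\<bar> ^ Suc 0 / fact (Suc 0)"
    unfolding norm_minus_cancel by (rule iexp_approx1)
  finally show ?thesis by (simp add: abs_mult)
qed

lemma energy_diff_translate_continuous:
  fixes u k :: "'a::euclidean_space \<Rightarrow> complex"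
  assumes u: "integrable lborel u" "continuous_on UNIV u" "\<And>x. cmod (u x) \<le> M"
    and band: "\<And>\<xi>. fourier u \<xi> \<noteq> 0 \<Longrightarrow> norm \<xi> \<le> D"
  shows "energy (\<lambda>x. u x - translate c u x) \<le> ennreal ((2 * pi * D * norm c)\<^sup>2) * energy u"
proof -
  have [measurable]: "u \<in> borel_measurable borel" using u by auto
  let ?v = "\<lambda>x. u x - translate c u x"
  have Tu: "integrable lborel (translate c u)"
    unfolding translate_def using u by (subst lborel_integrable_diff_iff) auto
  have v: "integrable lborel ?v" "continuous_on UNIV ?v" "\<And>x. cmod (?v x) \<le> M + M"
  proof -
    show "integrable lborel ?v" using u Tu by simp
    show "continuous_on UNIV ?v"
      unfolding translate_def by (intro continuous_intros u continuous_on_compose2[OF u(2)]) auto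
    show "cmod (?v x) \<le> M + M" for x
      unfolding translate_def by (intro order_trans[OF norm_triangle_ineq4] add_mono u)
  qed
  have meas_T [measurable]: "translate c u \<in> borel_measurable borel"
    using Tu by auto
  have fourier_v: "fourier ?v \<xi> = (1 - exp (- 2 * of_real pi * \<i> * of_real (c \<bullet> \<xi>))) * fourier u \<xi>" for \<xi>
  proof -
    have "fourier ?v \<xi> = fourier u \<xi> - fourier (translate c u) \<xi>"
      using integrable_fourier_kernel[OF u(1)] integrable_fourier_kernel[OF Tu]
      by (simp add: fourier_lborel left_diff_distrib)
    then show ?thesis
      by (simp only: fourier_translate[OF \<open>u \<in> _\<close>] left_diff_distrib mult_1)
  qed
  have "energy ?v = energy (fourier ?v)"
    by (rule plancherel_continuous(1)[OF v, symmetric])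
  also have "\<dots> \<le> (\<integral>\<^sup>+\<xi>. ennreal ((2 * pi * D * norm c)\<^sup>2) * ennreal ((cmod (fourier u \<xi>))\<^sup>2) \<partial>lborel)"
    unfolding energy_def
  proof (rule nn_integral_mono)
    fix \<xi> :: 'a
    have "cmod (fourier ?v \<xi>) \<le> (2 * pi * D * norm c) * cmod (fourier u \<xi>)"
    \<comment> \<open>Where the transform of \<open>u\<close> vanishes both sides are 0, so the
      multiplier has to be bounded only on the band.\<close>
    proof (cases "fourier u \<xi> = 0")
      case False
      have "2 * pi * \<bar>c \<bullet> \<xi>\<bar> \<le> 2 * pi * (norm c * norm \<xi>)"
        by (intro mult_left_mono Cauchy_Schwarz_ineq2) simp
      also have "\<dots> \<le> 2 * pi * (norm c * D)"
        by (intro mult_left_mono band False) simp_all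
      finally show ?thesis
        unfolding fourier_v norm_mult
        by (intro mult_right_mono order_trans[OF norm_1_minus_exp_le]) (simp_all add: ac_simps)
    qed (simp add: fourier_v)
    then have "(cmod (fourier ?v \<xi>))\<^sup>2 \<le> ((2 * pi * D * norm c) * cmod (fourier u \<xi>))\<^sup>2"
      by (rule power_mono) simp
    then show "ennreal ((cmod (fourier ?v \<xi>))\<^sup>2) \<le> ennreal ((2 * pi * D * norm c)\<^sup>2) * ennreal ((cmod (fourier u \<xi>))\<^sup>2)"
      by (simp add: power_mult_distrib flip: ennreal_mult)
  qed
  also have "\<dots> = ennreal ((2 * pi * D * norm c)\<^sup>2) * energy (fourier u)"
    unfolding energy_def by (rule nn_integral_cmult) measurable
  finally show ?thesis
    by (simp add: plancherel_continuous(1)[OF u])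
qed

text \<open>For the approximation \<open>u\<close>, the transform of \<open>conv u k\<close>
  vanishes wherever that of \<open>k\<close> does, so \<open>conv u k\<close> inherits the band of
  \<open>k\<close>. The energy on the right is that of the output, so that it can be summed over all
  paths afterwards.\<close>

lemma energy_conv_diff_translate_le:
  fixes h k :: "'a::euclidean_space \<Rightarrow> complex"
  assumes k: "integrable lborel k" and band: "\<And>\<xi>. fourier k \<xi> \<noteq> 0 \<Longrightarrow> norm \<xi> \<le> D"
    and h: "h \<in> borel_measurable borel" "energy h < \<infinity>"
  shows "energy (\<lambda>x. conv h k x - translate c (conv h k) x) \<le> ennreal ((2 * pi * D * norm c)\<^sup>2) * energy (conv h k)"
proof -
  define K where "K = ennreal ((LINT y|lborel. cmod (k y))\<^sup>2)"
  define L where "L = ennreal ((2 * pi * D * norm c)\<^sup>2)"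
  define C where "C t = ennreal (1 + t) * L * ennreal (1 + 1 / t) * K + ennreal (1 + 1 / t) * (4 * K)" for t
  have [measurable]: "h \<in> borel_measurable borel" "k \<in> borel_measurable borel" using h k by auto
  let ?F = "conv h k"
  have T_meas [measurable]: "translate c f \<in> borel_measurable borel" if [measurable]: "f \<in> borel_measurable borel" for f :: "'a \<Rightarrow> complex"
    unfolding translate_def by measurable
  have "energy (\<lambda>x. ?F x - translate c ?F x) \<le> L * energy ?F"
  proof (rule ennreal_le_perturb[where C = C])
    show "C t < top" for t
      by (simp add: C_def K_def L_def ennreal_mult_less_top)
  next
    fix t e :: real assume t: "t > 0" and e: "e > 0"
    define p where "p = ennreal (1 + t)"
    define q where "q = ennreal (1 + 1 / t)"
    have pp: "ennreal ((1 + t)\<^sup>2) = p * p"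
      using t by (simp add: p_def power2_eq_square ennreal_mult)
    note triangle = energy_triangle[where t = t, OF _ _ _ _ t, folded p_def q_def]
    obtain u M where u: "integrable lborel u" "continuous_on UNIV u" "\<And>x. cmod (u x) \<le> M"
      and hu: "energy (\<lambda>x. h x - u x) \<le> ennreal e"
      using exists_continuous_energy_approx[OF h, of "ennreal e"] e by auto
    have u_meas [measurable]: "u \<in> borel_measurable borel" using u by auto
    have Eu: "energy u < \<infinity>" by (rule plancherel_continuous(2)[OF u])
    let ?G = "conv u k"
    let ?d = "\<lambda>x. ?F x - ?G x"
    have d: "energy ?d \<le> K * ennreal e"
      unfolding K_def
      by (intro order_trans[OF energy_conv_diff_le[OF h u_meas Eu k]] mult_left_mono hu) simp
    \<comment> \<open>Translation preserves energy, so with \<open>t = 1\<close> the error and its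
      translate contribute 2 each; this is the 4 in \<open>C\<close>.\<close>
    have "energy (\<lambda>x. ?d x - translate c ?d x) \<le> ennreal (1 + 1) * energy ?d + ennreal (1 + 1 / 1) * energy (translate c ?d)"
      by (intro energy_triangle AE_I2 norm_triangle_ineq4) auto
    also have "\<dots> = 4 * energy ?d"
      by (simp add: energy_translate flip: distrib_right)
    also have "\<dots> \<le> 4 * (K * ennreal e)"
      by (intro mult_left_mono d) simp
    finally have dd: "energy (\<lambda>x. ?d x - translate c ?d x) \<le> 4 * (K * ennreal e)" .
    have "energy (\<lambda>x. ?F x - translate c ?F x) \<le> p * energy (\<lambda>x. ?G x - translate c ?G x)
        + q * energy (\<lambda>x. ?d x - translate c ?d x)"
    proof (intro triangle AE_I2)
      fix x
      have "?F x - translate c ?F x = (?G x - translate c ?G x) + (?d x - translate c ?d x)"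
        by (simp add: translate_def)
      then show "cmod (?F x - translate c ?F x) \<le> cmod (?G x - translate c ?G x) + cmod (?d x - translate c ?d x)"
        by (metis norm_triangle_ineq)
    qed measurable
    also have "\<dots> \<le> p * energy (\<lambda>x. ?G x - translate c ?G x) + q * (4 * (K * ennreal e))"
      by (intro add_left_mono mult_left_mono dd) simp
    also have "\<dots> \<le> p * (L * energy ?G) + q * (4 * (K * ennreal e))"
      unfolding L_def
      by (intro add_right_mono mult_left_mono energy_diff_translate_continuous[OF integrable_conv[OF u(1) k]
            continuous_on_conv[OF u(2,3) k] conv_bounded[OF u(2,3) k]])
         (use fourier_conv[OF u(1) k] band in auto)
    \<comment> \<open>The bound obtained involves the output of \<open>u\<close>; it is compared
      once more with the output of \<open>h\<close>, which yields the second factor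
      \<open>p\<close>.\<close>
    also have "\<dots> \<le> p * (L * (p * energy ?F + q * (K * ennreal e))) + q * (4 * (K * ennreal e))"
    proof (intro add_right_mono mult_left_mono)
      have "energy ?G \<le> p * energy ?F + q * energy ?d"
        by (intro triangle AE_I2 norm_triangle_sub[of "?G _" "?F _", unfolded norm_minus_commute[of "?G _"]]) measurable
      also have "\<dots> \<le> p * energy ?F + q * (K * ennreal e)"
        by (intro add_left_mono mult_left_mono d) simp
      finally show "energy ?G \<le> p * energy ?F + q * (K * ennreal e)" .
    qed simp_all
    finally show "energy (\<lambda>x. ?F x - translate c ?F x) \<le> ennreal ((1 + t)\<^sup>2) * (L * energy ?F) + C t * ennreal e"
      by (simp only: C_def pp p_def[symmetric] q_def[symmetric]) (simp only: distrib_left distrib_right ac_simps)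
  qed
  then show ?thesis by (simp add: L_def)
qed

section \<open>Scattering\<close>

lemma L1_borel_representative:
  assumes "g \<in> L1"
  obtains g' where "integrable lborel g'" "AE x in lborel. g x = g' x"
proof -
  have int: "integrable lebesgue g" using assms by (simp add: L1_def)
  then obtain g' where g': "g' \<in> borel_measurable borel" "AE x in lborel. g x = g' x"
    using borel_representative[of g] by auto
  have "integrable lebesgue g'"
    by (rule integrable_cong_AE_imp[OF int _ AE_completion[OF g'(2)]])
       (intro measurable_completion, simp add: g'(1))
  then have "integrable lborel g'"
    using g'(1) by (simp add: integrable_completion)
  then show ?thesis using g'(2) that by blast
qed

lemma L2_borel_representative:
  assumes "f \<in> L2"
  obtains f' where "f' \<in> borel_measurable borel" "energy f' < \<infinity>" "AE x in lborel. f x = f' x"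
proof -
  have f: "f \<in> borel_measurable lebesgue" "integrable lebesgue (\<lambda>x. (cmod (f x))\<^sup>2)"
    using assms by (auto simp: L2_def)
  obtain f' where f': "f' \<in> borel_measurable borel" "AE x in lborel. f x = f' x"
    using borel_representative[OF f(1)] by auto
  have "energy f' = energy f"
    by (rule energy_cong_AE) (use f'(2) in \<open>auto elim: eventually_mono\<close>)
  also have "\<dots> = (\<integral>\<^sup>+x. ennreal ((cmod (f x))\<^sup>2) \<partial>lebesgue)"
    by (simp add: energy_def nn_integral_completion)
  also have "\<dots> < \<infinity>"
    using f(2) by (simp add: nn_integral_eq_integral)
  finally show ?thesis using f' that by blast
qed

section \<open>Extended norms and finite sums of energies\<close>

lemma enn_sqrt_power2: "(enn_sqrt t)\<^sup>2 = t"
  by (cases t) (auto simp: enn_sqrt_def ennreal_power)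

lemma enn_sqrt_le:
  assumes "t \<le> b\<^sup>2"
  shows "enn_sqrt t \<le> b"
proof (cases b)
  case (real r)
  then have "t \<le> ennreal (r\<^sup>2)" using assms by (simp add: ennreal_power)
  then obtain s where "t = ennreal s" "0 \<le> s" "s \<le> r\<^sup>2"
    by (cases t) (auto simp: top_unique)
  then show ?thesis
    using real by (simp add: enn_sqrt_def real_le_lsqrt ennreal_leI)
qed simp

lemma L2_norm_power2: "(L2_norm f)\<^sup>2 = energy f"
  by (simp add: L2_norm_def enn_sqrt_power2 energy_def nn_integral_completion)

text \<open>In \<open>ennreal\<close> an infinite sum is the supremum of its finite partial sums, so
  both infinite path length and infinite alphabet reduce to finite sets of paths.\<close>

lemma L2l2_norm_le:
  assumes "\<And>F. finite F \<Longrightarrow> F \<subseteq> P \<Longrightarrow> (\<Sum>p\<in>F. energy (h p)) \<le> b\<^sup>2"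
  shows "L2l2_norm P h \<le> b"
  unfolding L2l2_norm_def L2_norm_power2
  by (rule enn_sqrt_le, rule infsum_le_finite_sums) (auto intro: nonneg_summable_on_complete assms)

lemma scatter_prop_Cons:
  "scatter_prop g (l # p) f = scatter_prop g p (\<lambda>x. of_real (cmod (conv f (g l) x)))"
  by (simp add: scatter_prop_def)

text \<open>Peeling off the first letter, not the last, makes the remaining path a scattering output
  of a new input; this suits inductions over an arbitrary input function.\<close>

lemma scatter_Cons:
  "scatter g0 g f (l # p) = scatter g0 g (\<lambda>x. of_real (cmod (conv f (g l) x))) p"
  by (simp add: scatter_def scatter_prop_Cons)

lemma conv_translate: "conv (translate c h) k = translate c (conv h k)"
  by (rule ext) (simp add: conv_def translate_def algebra_simps)

text \<open>Convolution and pointwise modulus each commute with translation at every point, so the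
  identity is one of functions and not merely almost everywhere.\<close>

lemma scatter_translate: "scatter g0 g (translate c f) p = translate c (scatter g0 g f p)"
proof (induction p arbitrary: f)
  case Nil
  then show ?case by (simp add: scatter_def scatter_prop_Nil conv_translate)
next
  case (Cons l p)
  have "(\<lambda>x. of_real (cmod (conv (translate c f) (g l) x)))
      = translate c (\<lambda>x. of_real (cmod (conv f (g l) x)))"
    unfolding conv_translate by (simp add: translate_def)
  then show ?case by (simp only: scatter_Cons Cons.IH)
qed

lemma scatter_borel_representative:
  fixes f f' :: "'a::euclidean_space \<Rightarrow> complex"
  assumes g0: "g0 \<in> borel_measurable lebesgue" "g0' \<in> borel_measurable borel" "AE x in lborel. g0 x = g0' x"
    and g: "\<And>l. l \<in> set p \<Longrightarrow> g l \<in> borel_measurable lebesgue"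
      "\<And>l. l \<in> set p \<Longrightarrow> g' l \<in> borel_measurable borel"
      "\<And>l. l \<in> set p \<Longrightarrow> AE x in lborel. g l x = g' l x"
    and f: "f \<in> borel_measurable lebesgue" "f' \<in> borel_measurable borel" "AE x in lborel. f x = f' x"
  shows "scatter g0 g f p = scatter g0' g' f' p"
  using g f
proof (induction p arbitrary: f f')
  case Nil
  then show ?case
    unfolding scatter_def scatter_prop_Nil
    using g0 by (intro conv_cong_AE) (simp_all add: measurable_completion)
next
  case (Cons l p)
  have l: "g l \<in> borel_measurable lebesgue" "g' l \<in> borel_measurable borel" "AE x in lborel. g l x = g' l x"
    using Cons.prems(1-3) by simp_all
  \<comment> \<open>The first convolution already removes the exceptional null sets of
    \<open>f\<close>: from here on both sides continue with the same Borel function.\<close>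
  have eq: "conv f (g l) = conv f' (g' l)"
    using l Cons.prems(4-6) by (intro conv_cong_AE) (simp_all add: measurable_completion)
  have [measurable]: "conv f' (g' l) \<in> borel_measurable borel"
    using l Cons.prems by simp
  have m: "(\<lambda>x. complex_of_real (cmod (conv f' (g' l) x))) \<in> borel_measurable borel" by measurable
  show ?case
    unfolding scatter_Cons eq
    by (rule Cons.IH) (use Cons.prems(1-3) m in \<open>auto intro: measurable_completion\<close>)
qed

lemma energy_cmod: "energy (\<lambda>x. of_real (cmod (f x))) = energy f"
  by (simp add: energy_def)

text \<open>Young's inequality keeps each layer in \<open>L2\<close>, as the multiplier bounds
  require of their input; taking the modulus leaves the energy unchanged.\<close>

lemma scatter_prop_energy_finite:
  fixes h :: "'a::euclidean_space \<Rightarrow> complex"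
  assumes "\<And>l. l \<in> set p \<Longrightarrow> integrable lborel (g l)"
    and "h \<in> borel_measurable borel" "energy h < \<infinity>"
  shows "scatter_prop g p h \<in> borel_measurable borel \<and> energy (scatter_prop g p h) < \<infinity>"
  using assms
proof (induction p arbitrary: h)
  case Nil
  then show ?case by (simp add: scatter_prop_Nil)
next
  case (Cons l p)
  have l: "integrable lborel (g l)" using Cons.prems by simp
  then have [measurable]: "g l \<in> borel_measurable borel" "h \<in> borel_measurable borel"
    using Cons.prems by auto
  have "energy (conv h (g l)) < \<infinity>"
    by (rule order.strict_trans1[OF energy_conv_le[OF _ l]])
       (use Cons.prems in \<open>auto simp: ennreal_mult_less_top\<close>)
  then show ?case
    unfolding scatter_prop_Cons using Cons.prems by (intro Cons.IH) (auto simp: energy_cmod)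
qed

lemma lists_length_le_Suc:
  "{p. set p \<subseteq> A \<and> length p \<le> Suc n} = insert [] ((\<lambda>(l, p). l # p) ` (A \<times> {p. set p \<subseteq> A \<and> length p \<le> n}))"
proof (intro set_eqI iffI)
  fix p assume "p \<in> {p. set p \<subseteq> A \<and> length p \<le> Suc n}"
  then show "p \<in> insert [] ((\<lambda>(l, p). l # p) ` (A \<times> {p. set p \<subseteq> A \<and> length p \<le> n}))"
    by (cases p) auto
qed auto

text \<open>Induction on the length with arbitrary input: the empty path contributes
  \<open>energy (conv h g0)\<close>, and the paths starting with \<open>l\<close> contribute the
  outputs of the modulus of \<open>conv h (g l)\<close>, which by induction sum to at most
  \<open>energy (conv h (g l))\<close>. One Bessel step then closes the estimate, so no remainder
  term from the deepest layer has to be followed.\<close>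

lemma sum_scatter_energy_le:
  fixes h :: "'a::euclidean_space \<Rightarrow> complex" and g :: "'b \<Rightarrow> 'a \<Rightarrow> complex"
  assumes A: "finite A" and g0: "integrable lborel g0" and g: "\<And>l. l \<in> A \<Longrightarrow> integrable lborel (g l)"
    and bessel: "\<And>\<xi>. ennreal ((cmod (fourier g0 \<xi>))\<^sup>2) + (\<Sum>l\<in>A. ennreal ((cmod (fourier (g l) \<xi>))\<^sup>2)) \<le> 1"
    and h: "h \<in> borel_measurable borel" "energy h < \<infinity>"
  shows "(\<Sum>p | set p \<subseteq> A \<and> length p \<le> n. energy (scatter g0 g h p)) \<le> energy h"
  using h
proof (induction n arbitrary: h)
  have step: "energy (conv h g0) + (\<Sum>l\<in>A. energy (conv h (g l))) \<le> energy h"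
    if "h \<in> borel_measurable borel" "energy h < \<infinity>" for h
  proof -
    \<comment> \<open>The index \<open>None\<close> stands for \<open>g0\<close>, so that
      \<open>g0\<close> and the \<open>g l\<close> enter the Bessel bound as a single finite
      family.\<close>
    have sum_eq: "(\<Sum>i\<in>insert None (Some ` A). F i) = F None + (\<Sum>l\<in>A. F (Some l))" for F :: "'b option \<Rightarrow> ennreal"
      using A by (subst sum.insert) (auto simp: sum.reindex)
    have "(\<Sum>i\<in>insert None (Some ` A). energy (conv h (case_option g0 g i))) \<le> energy h"
    proof (rule sum_energy_conv_le)
      show "integrable lborel (case_option g0 g i)" if "i \<in> insert None (Some ` A)" for i
        using that g0 g by auto
      show "(\<Sum>i\<in>insert None (Some ` A). ennreal ((cmod (fourier (case_option g0 g i) \<xi>))\<^sup>2)) \<le> 1" for \<xi>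
        unfolding sum_eq using bessel[of \<xi>] by simp
    qed (use A that in auto)
    then show ?thesis unfolding sum_eq by simp
  qed
  {
    case 0
    have "{p. set p \<subseteq> A \<and> length p \<le> 0} = {[]}" by auto
    then show ?case
      using order_trans[OF _ step[OF 0], of "energy (conv h g0)"] by (simp add: scatter_def scatter_prop_Nil)
  next
    case (Suc n)
    let ?S = "{p. set p \<subseteq> A \<and> length p \<le> n}"
    have fin: "finite ?S" using A by (rule finite_lists_length_le)
    let ?U = "\<lambda>l x. complex_of_real (cmod (conv h (g l) x))"
    have U: "?U l \<in> borel_measurable borel" "energy (?U l) < \<infinity>" if "l \<in> A" for l
      using scatter_prop_energy_finite[of "[l]" g h] g[OF that] Suc.prems
      by (simp_all add: scatter_prop_Cons scatter_prop_Nil)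
    have "(\<Sum>p | set p \<subseteq> A \<and> length p \<le> Suc n. energy (scatter g0 g h p))
        = energy (scatter g0 g h []) + (\<Sum>p\<in>(\<lambda>(l, p). l # p) ` (A \<times> ?S). energy (scatter g0 g h p))"
      unfolding lists_length_le_Suc by (rule sum.insert) (use A fin in auto)
    also have "(\<Sum>p\<in>(\<lambda>(l, p). l # p) ` (A \<times> ?S). energy (scatter g0 g h p))
        = (\<Sum>l\<in>A. \<Sum>p\<in>?S. energy (scatter g0 g (?U l) p))"
      by (subst sum.reindex) (auto simp: inj_on_def scatter_Cons sum.cartesian_product intro!: sum.cong)
    also have "energy (scatter g0 g h []) + \<dots> \<le> energy (conv h g0) + (\<Sum>l\<in>A. energy (conv h (g l)))"
      using Suc.IH[OF U] by (auto simp: scatter_def scatter_prop_Nil energy_cmod intro!: add_left_mono sum_mono)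
    also have "\<dots> \<le> energy h" by (rule step[OF Suc.prems])
    finally show ?case .
  }
qed

theorem mainTheorem3:
  fixes \<Lambda> :: "'l set"
    and g0 :: "real ^ 'd \<Rightarrow> complex"
    and g :: "'l \<Rightarrow> real ^ 'd \<Rightarrow> complex"
    and D :: real
    and f :: "real ^ 'd \<Rightarrow> complex"
    and c :: "real ^ 'd"
  assumes "uniform_covering_frame \<Lambda> g0 g"
    and "bdd_above {norm \<xi> | \<xi>. fourier g0 \<xi> \<noteq> 0}"
    and "D = Sup {norm \<xi> | \<xi>. fourier g0 \<xi> \<noteq> 0}"
    and "f \<in> L2"
  shows "L2l2_norm (lists \<Lambda>) (\<lambda>p x. scatter g0 g f p x - scatter g0 g (translate c f) p x)
           \<le> ennreal (2 * pi * D * norm c) * L2_norm f"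
proof -
  have frame: "g0 \<in> L1" "\<And>l. l \<in> \<Lambda> \<Longrightarrow> g l \<in> L1" "cmod (fourier g0 0) = 1"
      "\<And>\<xi>. ennreal ((cmod (fourier g0 \<xi>))\<^sup>2) + (\<Sum>\<^sub>\<infinity>l\<in>\<Lambda>. ennreal ((cmod (fourier (g l) \<xi>))\<^sup>2)) = 1"
    using assms(1) by (auto simp: uniform_covering_frame_def semi_discrete_Bessel_def)
  have band: "norm \<xi> \<le> D" if "fourier g0 \<xi> \<noteq> 0" for \<xi>
    unfolding assms(3) using that by (intro cSup_upper assms(2)) auto
  \<comment> \<open>The frequency 0 lies in the band because the transform of \<open>g0\<close> has
    modulus 1 there. The sign is needed when the constant is squared inside
    \<open>ennreal\<close>.\<close>
  have D: "D \<ge> 0"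
    using band[of 0] frame(3) by force
  obtain g0' where g0': "integrable lborel g0'" "AE x in lborel. g0 x = g0' x"
    using L1_borel_representative[OF frame(1)] by blast
  have "\<exists>g'. integrable lborel g' \<and> (AE x in lborel. g l x = g' x)" if "l \<in> \<Lambda>" for l
    using L1_borel_representative[OF frame(2)[OF that]] by blast
  then obtain g' where g': "\<And>l. l \<in> \<Lambda> \<Longrightarrow> integrable lborel (g' l)"
      "\<And>l. l \<in> \<Lambda> \<Longrightarrow> AE x in lborel. g l x = g' l x"
    by metis
  obtain f' where f': "f' \<in> borel_measurable borel" "energy f' < \<infinity>" "AE x in lborel. f x = f' x"
    using L2_borel_representative[OF assms(4)] by blast
  have meas: "f \<in> borel_measurable lebesgue" "g0 \<in> borel_measurable lebesgue"
      "\<And>l. l \<in> \<Lambda> \<Longrightarrow> g l \<in> borel_measurable lebesgue"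
    using assms(4) frame(1,2) by (auto simp: L2_def L1_def)
  have four0: "fourier g0' = fourier g0"
    using g0' meas(2) by (intro fourier_cong_AE) (auto intro: measurable_completion elim: eventually_mono)
  have four: "fourier (g' l) = fourier (g l)" if "l \<in> \<Lambda>" for l
    using g'[OF that] meas(3)[OF that]
    by (intro fourier_cong_AE) (auto intro: measurable_completion elim: eventually_mono)
  have scatter_eq: "scatter g0 g f p = scatter g0' g' f' p" if "p \<in> lists \<Lambda>" for p
    by (rule scatter_borel_representative[OF meas(2) borel_measurable_integrable[OF g0'(1), simplified] g0'(2)
          _ _ _ meas(1) f'(1,3)])
       (use that g' meas(3) borel_measurable_integrable in \<open>auto dest!: g'(1)\<close>)
  define L where "L = 2 * pi * D * norm c"
  have L: "L \<ge> 0" using D by (simp add: L_def)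
  have bound: "energy (\<lambda>x. scatter g0 g f p x - scatter g0 g (translate c f) p x)
      \<le> ennreal (L\<^sup>2) * energy (scatter g0' g' f' p)" if p: "p \<in> lists \<Lambda>" for p
  proof -
    have U: "scatter_prop g' p f' \<in> borel_measurable borel \<and> energy (scatter_prop g' p f') < \<infinity>"
      using p g' f' by (intro scatter_prop_energy_finite) auto
    \<comment> \<open>The translation is moved outside before representatives are exchanged, so only
      the unshifted \<open>f\<close> has to be replaced.\<close>
    then show ?thesis
      unfolding scatter_translate scatter_eq[OF p] unfolding scatter_def L_def
      using band four0 by (intro energy_conv_diff_translate_le g0') auto
  qed
  show ?thesis
  proof (rule L2l2_norm_le)
    fix F assume F: "finite F" "F \<subseteq> lists \<Lambda>"
    \<comment> \<open>The finitely many paths in \<open>F\<close> use finitely many letters and have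
      bounded length, so they lie in a finite tree covered by
      \<open>sum_scatter_energy_le\<close>.\<close>
    define A where "A = \<Union> (set ` F)"
    obtain n where n: "\<And>p. p \<in> F \<Longrightarrow> length p \<le> n"
      using F(1) finite_nat_set_iff_bounded_le[of "length ` F"] by auto
    have A: "finite A" "A \<subseteq> \<Lambda>" using F by (auto simp: A_def)
    have "(\<Sum>p\<in>F. energy (\<lambda>x. scatter g0 g f p x - scatter g0 g (translate c f) p x))
        \<le> (\<Sum>p\<in>F. ennreal (L\<^sup>2) * energy (scatter g0' g' f' p))"
      by (intro sum_mono bound subsetD[OF F(2)])
    also have "\<dots> = ennreal (L\<^sup>2) * (\<Sum>p\<in>F. energy (scatter g0' g' f' p))"
      by (simp add: sum_distrib_left)
    also have "\<dots> \<le> ennreal (L\<^sup>2) * energy f'"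
    proof (rule mult_left_mono)
      have "(\<Sum>p\<in>F. energy (scatter g0' g' f' p))
          \<le> (\<Sum>p | set p \<subseteq> A \<and> length p \<le> n. energy (scatter g0' g' f' p))"
        using n by (intro sum_mono2 finite_lists_length_le A) (auto simp: A_def)
      also have "\<dots> \<le> energy f'"
      proof (rule sum_scatter_energy_le[OF A(1) g0'(1) _ _ f'(1,2)])
        show "integrable lborel (g' l)" if "l \<in> A" for l
          using that A g' by auto
        fix \<xi>
        \<comment> \<open>The frame identity holds at every frequency, so dropping the letters
          outside \<open>A\<close> gives the Bessel bound pointwise.\<close>
        have "(\<Sum>l\<in>A. ennreal ((cmod (fourier (g' l) \<xi>))\<^sup>2)) = (\<Sum>l\<in>A. ennreal ((cmod (fourier (g l) \<xi>))\<^sup>2))"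
          using A four by (intro sum.cong) auto
        also have "\<dots> \<le> (\<Sum>\<^sub>\<infinity>l\<in>\<Lambda>. ennreal ((cmod (fourier (g l) \<xi>))\<^sup>2))"
          unfolding infsum_finite[OF A(1), symmetric]
          using A(2) by (intro infsum_mono_neutral nonneg_summable_on_complete) auto
        finally show "ennreal ((cmod (fourier g0' \<xi>))\<^sup>2) + (\<Sum>l\<in>A. ennreal ((cmod (fourier (g' l) \<xi>))\<^sup>2)) \<le> 1"
          unfolding frame(4)[of \<xi>, symmetric] four0 by (rule add_left_mono)
      qed
      finally show "(\<Sum>p\<in>F. energy (scatter g0' g' f' p)) \<le> energy f'" .
    qed simp
    also have "energy f' = energy f"
      using f'(3) by (intro energy_cong_AE) (auto elim: eventually_mono)
    also have "ennreal (L\<^sup>2) * energy f = (ennreal (2 * pi * D * norm c) * L2_norm f)\<^sup>2"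
      using L by (simp add: power_mult_distrib L2_norm_power2 ennreal_power L_def[symmetric])
    finally show "(\<Sum>p\<in>F. energy (\<lambda>x. scatter g0 g f p x - scatter g0 g (translate c f) p x))
        \<le> (ennreal (2 * pi * D * norm c) * L2_norm f)\<^sup>2" .
  qed
qed

end
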